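(* The Giry monad $(P,\mu,\delta)$ on the category of standard Borel spaces and measurable functions has weakly cartesian functor and weakly cartesian multiplication. That is, $P$ preserves weak pullbacks, and for every measurable function $f:X\to Y$ between standard Borel spaces the naturality square $\mu_Y\circ PPf=Pf\circ\mu_X$ (with sides $PPf:PPX\to PPY$, $\mu_X:PPX\to PX$, $\mu_Y:PPY\to PY$, $Pf:PX\to PY$) is a weak pullback.
   Context: Giry monad on standard Borel spaces: for a standard Borel space $X$, $PX$ is the set of probability measures on $X$ with the $\sigma$-algebra generated by the evaluation maps $p\mapsto p(A)$ for measurable $A\subseteq X$ (again standard Borel); $Pf$ is pushforward of measures along $f$; $\delta_X(x)$ is the Dirac measure at $x$; and $\mu_X(\pi)(A)=\int_{PX}p(A)\,\pi(dp)$. Weak pullback: a commutative square $m\circ f=n\circ g$ (with $f:A\to B$, $g:A\to C$, $m:B\to D$, $n:C\to D$) in a category is a weak pullback if for every object $S$ and all morphisms $q:S\to B$, $p:S\to C$ with $m\circ q=n\circ p$ there is a (not necessarily unique) morphism $r:S\to A$ with $f\circ r=q$ and $g\circ r=p$. The functor $T$ of a monad $(T,\mu,\eta)$ is weakly cartesian if it preserves weak pullbacks; $\mu$ is weakly cartesian if all its naturality squares are weak pullbacks. *)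

theory Defs
  imports "HOL-Probability.Probability"
begin

text \<open>
  A measurable space is given by a term of type \<^typ>\<open>'a measure\<close>, of which only the carrier and the
  sigma-algebra are used. It is standard Borel if its sigma-algebra is the Borel sigma-algebra of
  some Polish (separable, completely metrizable) topology on its carrier; the empty space is
  included.
\<close>

definition standard_borel :: "'a measure \<Rightarrow> bool" where
  "standard_borel M \<longleftrightarrow>
    (\<exists>T. completely_metrizable_space T \<and> second_countable T \<and> topspace T = space M \<and>
         sets M = sigma_sets (topspace T) {U. openin T U})"

text \<open>
  HOL functions are total on their types, so two morphisms out of \<open>A\<close> are equal if they agree on
  \<^term>\<open>space A\<close>.

  The squares \<open>m \<circ> f = n \<circ> g\<close> below live in the category of standard Borel spaces and measurable
  functions. HOL cannot quantify over types inside a formula, so the type \<open>'s\<close> on which the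
  test objects \<open>S\<close> live is an explicit parameter. Every standard Borel space is isomorphic to one
  carried by a set of reals, so \<^term>\<open>TYPE(real)\<close> already tests against all of them.
\<close>

definition sb_hom :: "'a measure \<Rightarrow> 'b measure \<Rightarrow> ('a \<Rightarrow> 'b) set" where
  "sb_hom A B = {f. standard_borel A \<and> standard_borel B \<and> f \<in> A \<rightarrow>\<^sub>M B}"

definition weak_pullback ::
  "'s itself \<Rightarrow> 'a measure \<Rightarrow> 'b measure \<Rightarrow> 'c measure \<Rightarrow> 'd measure \<Rightarrow>
   ('a \<Rightarrow> 'b) \<Rightarrow> ('a \<Rightarrow> 'c) \<Rightarrow> ('b \<Rightarrow> 'd) \<Rightarrow> ('c \<Rightarrow> 'd) \<Rightarrow> bool" where
  "weak_pullback (_ :: 's itself) A B C D f g m n \<longleftrightarrow>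
    f \<in> sb_hom A B \<and> g \<in> sb_hom A C \<and> m \<in> sb_hom B D \<and> n \<in> sb_hom C D \<and>
    (\<forall>x\<in>space A. m (f x) = n (g x)) \<and>
    (\<forall>S :: 's measure. \<forall>q\<in>sb_hom S B. \<forall>p\<in>sb_hom S C.
       (\<forall>s\<in>space S. m (q s) = n (p s)) \<longrightarrow>
       (\<exists>r\<in>sb_hom S A. \<forall>s\<in>space S. f (r s) = q s \<and> g (r s) = p s))"

text \<open>
  The object part of the Giry functor is \<^const>\<open>prob_algebra\<close>; its action on a morphism with
  codomain \<open>Y\<close> is pushforward.
\<close>

abbreviation giry_map :: "'b measure \<Rightarrow> ('a \<Rightarrow> 'b) \<Rightarrow> 'a measure \<Rightarrow> 'b measure" where
  "giry_map Y f \<equiv> (\<lambda>p. distr p Y f)"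

text \<open>
  The library's \<^const>\<open>join\<close> is the multiplication for sub-probability measures: it is
  meaningful only on measures over a \<^const>\<open>subprob_algebra\<close>, not over a
  \<^const>\<open>prob_algebra\<close>.
\<close>

definition giry_mult :: "'a measure \<Rightarrow> 'a measure measure \<Rightarrow> 'a measure" where
  "giry_mult X \<pi> = measure_of (space X) (sets X) (\<lambda>A. \<integral>\<^sup>+ p. emeasure p A \<partial>\<pi>)"

lemma giry_mult_eq_bind:
  assumes "\<pi> \<in> space (prob_algebra (prob_algebra X))"
  shows "giry_mult X \<pi> = \<pi> \<bind> (\<lambda>p. p)"
proof -
  have s: "sets \<pi> = sets (prob_algebra X)" and P: "prob_space \<pi>"
    using assms by (auto simp: space_prob_algebra)
  have ne: "space \<pi> \<noteq> {}"
    using P by (rule prob_space.not_empty)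
  have meas: "(\<lambda>p. p) \<in> \<pi> \<rightarrow>\<^sub>M subprob_algebra X"
    using measurable_prob_algebraD[of "\<lambda>p. p" "prob_algebra X" X] s
    by (simp cong: measurable_cong_sets)
  have sb: "sets (\<pi> \<bind> (\<lambda>p. p)) = sets X"
    using sets_bind_measurable[OF meas ne] .
  have "\<pi> \<bind> (\<lambda>p. p) = measure_of (space X) (sets X) (emeasure (\<pi> \<bind> (\<lambda>p. p)))"
    using sb sets_eq_imp_space_eq[OF sb] measure_of_of_measure[of "\<pi> \<bind> (\<lambda>p. p)"] by simp
  also have "\<dots> = giry_mult X \<pi>"
    unfolding giry_mult_def
    by (intro measure_of_eq)
       (auto simp: sets.sigma_sets_eq sets.space_closed emeasure_bind[OF ne meas])
  finally show ?thesis by simp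
qed

lemma emeasure_giry_mult:
  assumes "\<pi> \<in> space (prob_algebra (prob_algebra X))" and "A \<in> sets X"
  shows "emeasure (giry_mult X \<pi>) A = (\<integral>\<^sup>+ p. emeasure p A \<partial>\<pi>)"
proof -
  have s: "sets \<pi> = sets (prob_algebra X)" and P: "prob_space \<pi>"
    using assms by (auto simp: space_prob_algebra)
  have "(\<lambda>p. p) \<in> \<pi> \<rightarrow>\<^sub>M subprob_algebra X"
    using measurable_prob_algebraD[of "\<lambda>p. p" "prob_algebra X" X] s
    by (simp cong: measurable_cong_sets)
  then show ?thesis
    using assms prob_space.not_empty[OF P]
    by (simp add: giry_mult_eq_bind emeasure_bind)
qed

end

theory Submission
  imports Defs
begin

text \<open>
  Both halves of the theorem rest on one analytic fact, \<open>disintegration\<close>: for a measurable map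
  \<open>h\<close> from \<open>C\<close> to \<open>D\<close> between standard Borel spaces there is a kernel \<open>k\<close>, jointly
  measurable in \<open>p \<in> PC\<close> and \<open>y \<in> D\<close>, such that \<open>p\<close> is the mixture of the measures
  \<open>k (p, y)\<close> over the pushforward of \<open>p\<close>, and for almost every \<open>y\<close> the measure \<open>k (p, y)\<close>
  lives on the fibre of \<open>h\<close> over \<open>y\<close>. Measurability in \<open>p\<close> is what turns a construction
  for single measures into a morphism out of an arbitrary test object.

  Weak pullbacks: let \<open>q\<close> and \<open>p\<close> be families of measures on \<open>B\<close> and \<open>C\<close> with the same image
  on \<open>D\<close>. Draw \<open>b\<close> from \<open>q s\<close>, then draw \<open>c\<close> from the disintegration of \<open>p s\<close> along \<open>n\<close>
  over the point \<open>m b\<close>. The pair has the marginals \<open>q s\<close> and \<open>p s\<close>, and almost surely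
  \<open>m b = n c\<close>. The given square, tested on the space of all such pairs, provides a measurable
  \<open>t\<close> that lifts them to \<open>A\<close>; the law of \<open>t (b, c)\<close> is the required measure on \<open>A\<close>.

  Multiplication: let \<open>q s\<close> be a measure on \<open>PY\<close> whose mean is the pushforward of \<open>p s\<close>
  along \<open>h\<close>. With \<open>k\<close> the disintegration along \<open>h\<close>, send \<open>\<rho> \<in> PY\<close> to the mixture of the
  \<open>k (p s, y)\<close> over \<open>\<rho>\<close>. The image of \<open>q s\<close> under this map has mean \<open>p s\<close>, and for
  \<open>q s\<close>-almost every \<open>\<rho>\<close> the mixture is pushed back to \<open>\<rho>\<close> by \<open>h\<close>.

  To handle standard Borel spaces uniformly, it is shown that the nonempty ones are exactly the
  measurable retracts of the Cantor space \<open>nat \<Rightarrow> bool\<close>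
  (\<open>standard_borel_iff_meas_retract_cantor\<close>). Retracts are stable under products,
  nonempty measurable subsets and \<^const>\<open>prob_algebra\<close>, so that only the Cantor space itself needs real
  work. A probability measure on it is the same as a system of additive weights on its cylinders.
  This makes \<^const>\<open>prob_algebra\<close> of the Cantor space a retract of a Polish space of weights,
  whence \<open>standard_borel_prob_algebra\<close>, and it reduces the construction of conditional
  distributions to the convergence of their weights. These weights are limits of elementary
  conditional probabilities given longer and longer initial segments of \<open>y\<close>, a bounded martingale.
\<close>

section \<open>Measurable retracts\<close>

text \<open>
  In the category of measurable spaces, \<open>M\<close> is a retract of \<open>N\<close>. The map \<open>i\<close> is then an
  isomorphism onto the measurable set of fixed points of \<open>i \<circ> r\<close>, as soon as the diagonal of \<open>N\<close>
  is measurable; keeping the total map \<open>r\<close> avoids subspaces and partial inverses altogether.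
\<close>

definition meas_retract :: "'a measure \<Rightarrow> 'b measure \<Rightarrow> bool" where
  "meas_retract M N \<longleftrightarrow>
    (\<exists>i r. i \<in> M \<rightarrow>\<^sub>M N \<and> r \<in> N \<rightarrow>\<^sub>M M \<and> (\<forall>x\<in>space M. r (i x) = x))"

lemma meas_retractE:
  assumes "meas_retract M N"
  obtains i r where "i \<in> M \<rightarrow>\<^sub>M N" "r \<in> N \<rightarrow>\<^sub>M M" "\<forall>x\<in>space M. r (i x) = x"
  using assms unfolding meas_retract_def by blast

lemma meas_retract_trans:
  assumes "meas_retract L M" "meas_retract M N"
  shows "meas_retract L N"
proof -
  obtain i r where 1: "i \<in> L \<rightarrow>\<^sub>M M" "r \<in> M \<rightarrow>\<^sub>M L" "\<forall>x\<in>space L. r (i x) = x"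
    using assms(1) by (rule meas_retractE)
  obtain j s where 2: "j \<in> M \<rightarrow>\<^sub>M N" "s \<in> N \<rightarrow>\<^sub>M M" "\<forall>x\<in>space M. s (j x) = x"
    using assms(2) by (rule meas_retractE)
  show ?thesis
    unfolding meas_retract_def
    using measurable_compose[OF 1(1) 2(1)] measurable_compose[OF 2(2) 1(2)]
      measurable_space[OF 1(1)] 1(3) 2(3)
    by (intro exI[of _ "\<lambda>x. j (i x)"] exI[of _ "\<lambda>y. r (s y)"]) auto
qed

lemma meas_retract_pair:
  assumes "meas_retract M N" "meas_retract M' N'"
  shows "meas_retract (M \<Otimes>\<^sub>M M') (N \<Otimes>\<^sub>M N')"
proof -
  obtain i r where [measurable]: "i \<in> M \<rightarrow>\<^sub>M N" "r \<in> N \<rightarrow>\<^sub>M M"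
    and 1: "\<forall>x\<in>space M. r (i x) = x"
    using assms(1) by (rule meas_retractE)
  obtain j s where [measurable]: "j \<in> M' \<rightarrow>\<^sub>M N'" "s \<in> N' \<rightarrow>\<^sub>M M'"
    and 2: "\<forall>x\<in>space M'. s (j x) = x"
    using assms(2) by (rule meas_retractE)
  show ?thesis
    unfolding meas_retract_def
    by (intro exI[of _ "\<lambda>x. (i (fst x), j (snd x))"] exI[of _ "\<lambda>y. (r (fst y), s (snd y))"])
       (auto simp: space_pair_measure 1 2)
qed

text \<open>Outside of \<open>E\<close> the retraction is constant, which is why \<open>E\<close> has to be nonempty.\<close>

lemma meas_retract_restrict_space:
  assumes "E \<in> sets M" "E \<noteq> {}"
  shows "meas_retract (restrict_space M E) M"
proof -
  obtain x where x: "x \<in> E" using assms(2) by auto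
  have "(\<lambda>y. if y \<in> E then y else x) \<in> M \<rightarrow>\<^sub>M restrict_space M E"
    using assms(1) x sets.sets_into_space[OF assms(1)]
    by (intro measurable_restrict_space2) (auto intro!: measurable_If_set)
  then show ?thesis
    unfolding meas_retract_def
    by (intro exI[of _ "\<lambda>x. x"] exI[of _ "\<lambda>y. if y \<in> E then y else x"])
       (auto simp: space_restrict_space intro!: measurable_restrict_space1)
qed

text \<open>Functors preserve retracts.\<close>

lemma meas_retract_prob_algebra:
  assumes "meas_retract M N"
  shows "meas_retract (prob_algebra M) (prob_algebra N)"
proof -
  obtain i r where i: "i \<in> M \<rightarrow>\<^sub>M N" and r: "r \<in> N \<rightarrow>\<^sub>M M"
    and 1: "\<forall>x\<in>space M. r (i x) = x"
    using assms by (rule meas_retractE)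
  have "distr (distr p N i) M r = p" if p: "p \<in> space (prob_algebra M)" for p
  proof -
    have s: "sets p = sets M" using p by (simp add: space_prob_algebra)
    then have "i \<in> p \<rightarrow>\<^sub>M N" using i by (simp cong: measurable_cong_sets)
    then have "distr (distr p N i) M r = distr p M (\<lambda>x. r (i x))"
      using r by (simp add: distr_distr comp_def)
    also have "\<dots> = distr p M (\<lambda>x. x)"
      using sets_eq_imp_space_eq[OF s] 1 by (intro distr_cong) auto
    finally show ?thesis using distr_id2[of M p] s by simp
  qed
  then show ?thesis
    unfolding meas_retract_def
    using measurable_distr_prob_space[OF i] measurable_distr_prob_space[OF r] by blast
qed

section \<open>The Cantor space\<close>

instance bool :: second_countable_topology
proof
  have "open = generate_topology (UNIV::bool set set)"
    by (simp add: fun_eq_iff discrete_topology_class.open_discrete generate_topology.Basis)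
  then show "\<exists>B::bool set set. countable B \<and> open = generate_topology B"
    by (metis countable_finite finite)
qed

abbreviation cantor :: "(nat \<Rightarrow> bool) measure" where
  "cantor \<equiv> borel"

lemma measurable_bit [measurable]: "Measurable.pred cantor (\<lambda>a. a n)"
  using measurable_product_coordinates[of n, where 'b=bool] sets_borel_eq_count_space[where 'a=bool]
  by (metis measurable_cong_sets)

lemma measurable_bit_of:
  assumes "f \<in> M \<rightarrow>\<^sub>M cantor"
  shows "Measurable.pred M (\<lambda>x. f x n)"
  by (rule measurable_compose[OF assms measurable_bit])

lemma measurable_to_cantor:
  assumes "\<And>n. Measurable.pred M (\<lambda>x. f x n)"
  shows "f \<in> M \<rightarrow>\<^sub>M cantor"
proof (rule measurable_coordinatewise_then_product)
  show "(\<lambda>x. f x n) \<in> borel_measurable M" for n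
    using assms[of n] sets_borel_eq_count_space[where 'a=bool] by (metis measurable_cong_sets)
qed

text \<open>
  The Borel sigma-algebra and the topology of the Cantor space come from the type classes on
  functions, but \<^typ>\<open>bool\<close> carries no metric, so complete metrizability is transferred from
  the discrete topology.
\<close>

lemma completely_metrizable_cantor:
  "completely_metrizable_space (euclidean :: (nat \<Rightarrow> bool) topology)"
proof -
  have "completely_metrizable_space (euclidean :: bool topology)"
  proof -
    have "(euclidean :: bool topology) = discrete_topology UNIV"
      by (simp add: topology_eq discrete_topology_class.open_discrete)
    then show ?thesis by (simp add: completely_metrizable_space_discrete_topology)
  qed
  then show ?thesis
    unfolding euclidean_product_topology[symmetric] completely_metrizable_space_product_topology
    by auto
qed

section \<open>Retracts of the Cantor space are standard Borel\<close>

abbreviation gdelta_set :: "'a::topological_space set \<Rightarrow> bool" where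
  "gdelta_set \<equiv> gdelta_in euclidean"

lemma gdelta_vimage:
  assumes "gdelta_set S" "continuous_on UNIV f"
  shows "gdelta_set (f -` S)"
proof -
  obtain C where C: "\<And>n. open (C n)" "\<And>n::nat. C (Suc n) \<subseteq> C n" "\<Inter> (range C) = S"
    using assms(1) unfolding gdelta_in_descending by auto
  show ?thesis
    unfolding gdelta_in_descending
  proof (intro exI conjI allI)
    show "openin euclidean (f -` C n)" for n
      using open_vimage[OF C(1) assms(2)] by simp
    show "f -` C (Suc n) \<subseteq> f -` C n" for n using C(2) by auto
    show "\<Inter> (range (\<lambda>n. f -` C n)) = f -` S" using C(3) by auto
  qed
qed

lemma gdelta_INT:
  assumes "\<And>n::nat. gdelta_set (S n)"
  shows "gdelta_set (\<Inter>n. S n)"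
  using assms by (intro gdelta_in_Inter) auto

lemma continuous_bool_clopen:
  fixes f :: "'a::topological_space \<Rightarrow> bool"
  assumes "continuous_on UNIV f"
  shows "open {x. f x}" "closed {x. f x}"
proof -
  have "open (f -` {True})" "open (f -` {False})"
    using assms by (auto intro!: open_vimage discrete_topology_class.open_discrete)
  moreover have "f -` {True} = {x. f x}" "f -` {False} = - {x. f x}" by auto
  ultimately show "open {x. f x}" "closed {x. f x}" by (auto simp: closed_def)
qed

text \<open>
  A \<open>G\<^sub>\<delta>\<close> subset of a Polish space is Polish, and pulling its topology back along an injection
  gives a Polish topology on \<open>M\<close>.
\<close>

lemma standard_borel_if_gdelta_image:
  fixes e :: "'a \<Rightarrow> 'b::second_countable_topology"
  assumes cm: "completely_metrizable_space (euclidean :: 'b topology)"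
    and inj: "inj_on e (space M)" and G: "gdelta_set (e ` space M)"
    and sets: "sets M = sets (vimage_algebra (space M) e borel)"
  shows "standard_borel M"
proof -
  define T where "T = pullback_topology (space M) e euclidean"
  have ts: "topspace T = space M"
    unfolding T_def by (simp add: topspace_pullback_topology)
  have op: "openin T S \<longleftrightarrow> (\<exists>U. open U \<and> S = e -` U \<inter> space M)" for S
    unfolding T_def openin_pullback_topology by simp
  have "homeomorphic_map T (top_of_set (e ` space M)) e"
    unfolding homeomorphic_eq_everything_map
  proof (intro conjI)
    show "inj_on e (topspace T)" using inj ts by simp
    show "e ` topspace T = topspace (top_of_set (e ` space M))" using ts by simp
    show "continuous_map T (top_of_set (e ` space M)) e"
      unfolding continuous_map_def
      by (auto simp: ts op openin_subtopology)
    show om: "open_map T (top_of_set (e ` space M)) e"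
      unfolding open_map_def
    proof (intro allI impI)
      fix S assume "openin T S"
      then obtain U where "open U" "S = e -` U \<inter> space M" using op by auto
      then have "e ` S = e ` space M \<inter> U" by auto
      then show "openin (top_of_set (e ` space M)) (e ` S)" using \<open>open U\<close> by (auto simp: openin_open)
    qed
    show "closed_map T (top_of_set (e ` space M)) e"
      using om inj \<open>e ` topspace T = _\<close> ts
      by (metis bijective_open_imp_closed_map)
  qed
  then have h: "T homeomorphic_space top_of_set (e ` space M)"
    by (rule homeomorphic_map_imp_homeomorphic_space)
  have 1: "completely_metrizable_space T"
    using homeomorphic_completely_metrizable_space[OF h] completely_metrizable_space_gdelta_in[OF cm G]
    by simp
  obtain B :: "'b set set" where B: "countable B" "\<And>V. V \<in> B \<Longrightarrow> open V"
    "\<And>U. open U \<Longrightarrow> \<exists>B'. B' \<subseteq> B \<and> U = \<Union>B'"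
    using univ_second_countable by blast
  have 2: "second_countable T"
    unfolding second_countable_def
  proof (intro exI conjI)
    let ?B = "(\<lambda>V. e -` V \<inter> space M) ` B"
    show "countable ?B" using B by simp
    show "\<forall>V\<in>?B. openin T V" using B op by auto
    show "\<forall>U x. openin T U \<and> x \<in> U \<longrightarrow> (\<exists>V\<in>?B. x \<in> V \<and> V \<subseteq> U)"
    proof (intro allI impI, elim conjE)
      fix U x assume "openin T U" "x \<in> U"
      then obtain U' where U': "open U'" "U = e -` U' \<inter> space M" using op by auto
      obtain B' where "B' \<subseteq> B" "U' = \<Union>B'" using B(3)[OF U'(1)] by blast
      with U' \<open>x \<in> U\<close> show "\<exists>V\<in>?B. x \<in> V \<and> V \<subseteq> U" by fastforce
    qed
  qed
  have "sets M = sets (vimage_algebra (space M) e (sigma UNIV {U. open U}))"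
    unfolding sets borel_def ..
  also have "\<dots> = sigma_sets (space M) {e -` A \<inter> space M | A. A \<in> {U. open U}}"
    by (subst vimage_algebra_sigma) (auto intro!: sets_measure_of)
  also have "{e -` A \<inter> space M | A. A \<in> {U. open U}} = {U. openin T U}"
    by (auto simp: op)
  finally show ?thesis
    unfolding standard_borel_def using 1 2 ts by metis
qed

text \<open>
  This is the classical fact that a Borel set can be made clopen by refining the Polish topology
  without changing the Borel sets. The refined topology is encoded by a measurable map \<open>c\<close> whose
  graph is a \<open>G\<^sub>\<delta>\<close> set: it is the topology of the graph, transported to the first coordinate.
  Membership in \<open>E\<close> is read off from the first bit of \<open>c a\<close>. A complement is handled by
  prepending the negation of that bit, a countable union by interleaving the given maps and
  prepending the disjunction of their first bits.
\<close>

lemma borel_set_gdelta_refinement: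
  assumes "E \<in> sets cantor"
  shows "\<exists>c \<in> cantor \<rightarrow>\<^sub>M cantor. gdelta_set {(a, c a) | a. True} \<and> (\<forall>a. c a 0 \<longleftrightarrow> a \<in> E)"
proof -
  have met: "metrizable_space (euclidean :: ((nat \<Rightarrow> bool) \<times> (nat \<Rightarrow> bool)) topology)"
    using completely_metrizable_cantor
    by (metis completely_metrizable_imp_metrizable_space completely_metrizable_space_prod_topology
        prod_topology_euclidean)
  have cl: "gdelta_set S" if "closed S" for S :: "((nat \<Rightarrow> bool) \<times> (nat \<Rightarrow> bool)) set"
    using closed_imp_gdelta_in[OF met] that by simp
  have opn: "gdelta_set S" if "open S" for S :: "((nat \<Rightarrow> bool) \<times> (nat \<Rightarrow> bool)) set"
    using open_imp_gdelta_in[of euclidean S] that by simp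
  have bit: "continuous_on UNIV (\<lambda>x::(nat \<Rightarrow> bool) \<times> (nat \<Rightarrow> bool). snd x n)"
            "continuous_on UNIV (\<lambda>x::(nat \<Rightarrow> bool) \<times> (nat \<Rightarrow> bool). fst x n)" for n
    by (rule continuous_on_product_then_coordinatewise, intro continuous_intros)+
  note clop = continuous_bool_clopen[OF bit(1)] continuous_bool_clopen[OF bit(2)]
  let ?P = "\<lambda>E. \<exists>c \<in> cantor \<rightarrow>\<^sub>M cantor. gdelta_set {(a, c a) | a. True} \<and> (\<forall>a. c a 0 \<longleftrightarrow> a \<in> E)"
  have compl: "?P (UNIV - E)" if E: "?P E" for E
  proof -
    obtain c where cm: "c \<in> cantor \<rightarrow>\<^sub>M cantor"
      and G: "gdelta_set {(a, c a) | a. True}" and c: "\<And>a. c a 0 \<longleftrightarrow> a \<in> E"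
      using E by auto
    define c' where "c' a n = (case n of 0 \<Rightarrow> \<not> c a 0 | Suc n \<Rightarrow> c a n)" for a n
    have "c' \<in> cantor \<rightarrow>\<^sub>M cantor"
    proof (rule measurable_to_cantor)
      show "Measurable.pred cantor (\<lambda>a. c' a n)" for n
        unfolding c'_def using measurable_bit_of[OF cm] by (cases n) simp_all
    qed
    moreover have "{(a, c' a) | a. True} =
       ({x. snd x 0} \<inter> - {x. snd x 1} \<union> - {x. snd x 0} \<inter> {x. snd x 1}) \<inter>
       (\<lambda>x. (fst x, \<lambda>n. snd x (Suc n))) -` {(a, c a) | a. True}"
      (is "_ = ?R")
    proof (intro set_eqI)
      fix x
      have *: "x = (a, c' a) \<longleftrightarrow> (a = fst x \<and> snd x 0 = (\<not> snd x 1) \<and> (\<lambda>n. snd x (Suc n)) = c a)" for a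
      proof
        assume r: "a = fst x \<and> snd x 0 = (\<not> snd x 1) \<and> (\<lambda>n. snd x (Suc n)) = c a"
        then have r': "snd x (Suc n) = c a n" for n by (metis (full_types))
        have "snd x n = c' a n" for n
          using r r'[of 0] r' by (cases n) (simp_all add: c'_def)
        then have "snd x = c' a" by (rule ext)
        then show "x = (a, c' a)" using r by (simp add: prod_eq_iff)
      qed (auto simp: c'_def fun_eq_iff)
      show "x \<in> {(a, c' a) | a. True} \<longleftrightarrow> x \<in> ?R"
        by (simp add: *) auto
    qed
    moreover have "gdelta_set \<dots>"
    proof (intro gdelta_in_Int gdelta_in_Un gdelta_vimage[OF G])
      show "continuous_on UNIV (\<lambda>x :: (nat \<Rightarrow> bool) \<times> (nat \<Rightarrow> bool). (fst x, \<lambda>n. snd x (Suc n)))"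
        by (intro continuous_on_Pair continuous_on_coordinatewise_then_product bit continuous_intros)
    qed (intro opn clop open_Compl)+
    ultimately show ?thesis
      using c by (intro bexI[of _ c']) (auto simp: c'_def)
  qed
  have un: "?P (\<Union>i. E i)" if E: "\<And>i. ?P (E i)" for E :: "nat \<Rightarrow> (nat \<Rightarrow> bool) set"
  proof -
    have "\<forall>i. \<exists>c. c \<in> cantor \<rightarrow>\<^sub>M cantor \<and> gdelta_set {(a, c a) | a. True} \<and> (\<forall>a. c a 0 \<longleftrightarrow> a \<in> E i)"
      using E by blast
    from choice[OF this] obtain c where *: "\<forall>i. c i \<in> cantor \<rightarrow>\<^sub>M cantor \<and>
        gdelta_set {(a, c i a) | a. True} \<and> (\<forall>a. c i a 0 \<longleftrightarrow> a \<in> E i)" ..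
    have cm: "c i \<in> cantor \<rightarrow>\<^sub>M cantor" and G: "gdelta_set {(a, c i a) | a. True}"
      and c: "c i a 0 \<longleftrightarrow> a \<in> E i" for i a
      using * by blast+
    define c' where "c' a n = (case n of 0 \<Rightarrow> \<exists>i. c i a 0
      | Suc n \<Rightarrow> c (fst (prod_decode n)) a (snd (prod_decode n)))" for a n
    have "c' \<in> cantor \<rightarrow>\<^sub>M cantor"
    proof (rule measurable_to_cantor)
      show "Measurable.pred cantor (\<lambda>a. c' a n)" for n
        unfolding c'_def using measurable_bit_of[OF cm] by (cases n) simp_all
    qed
    moreover have "{(a, c' a) | a. True} =
       ((- {x. snd x 0} \<union> (\<Union>i. {x. snd x (Suc (prod_encode (i, 0)))})) \<inter>
        ({x. snd x 0} \<union> - (\<Union>i. {x. snd x (Suc (prod_encode (i, 0)))}))) \<inter>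
       (\<Inter>i. (\<lambda>x. (fst x, \<lambda>j. snd x (Suc (prod_encode (i, j))))) -` {(a, c i a) | a. True})"
      (is "_ = ?R")
    proof (intro set_eqI)
      fix x
      have *: "x = (a, c' a) \<longleftrightarrow> (a = fst x \<and> (snd x 0 \<longleftrightarrow> (\<exists>i. snd x (Suc (prod_encode (i, 0))))) \<and>
          (\<forall>i. (\<lambda>j. snd x (Suc (prod_encode (i, j)))) = c i a))" (is "_ \<longleftrightarrow> ?r a") for a
      proof
        assume r: "?r a"
        then have r': "snd x (Suc (prod_encode (i, j))) = c i a j" for i j by (metis (full_types))
        have "snd x n = c' a n" for n
        proof (cases n)
          case 0
          then show ?thesis using r r' by (simp add: c'_def)
        next
          case (Suc m)
          then show ?thesis
            using r'[of "fst (prod_decode m)" "snd (prod_decode m)"] by (simp add: c'_def)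
        qed
        then have "snd x = c' a" by (rule ext)
        then show "x = (a, c' a)" using r by (simp add: prod_eq_iff)
      qed (auto simp: c'_def fun_eq_iff)
      show "x \<in> {(a, c' a) | a. True} \<longleftrightarrow> x \<in> ?R"
        by (simp add: *) auto
    qed
    moreover have "gdelta_set \<dots>"
    proof (intro gdelta_in_Int gdelta_INT gdelta_in_Un gdelta_vimage[OF G])
      show "continuous_on UNIV (\<lambda>x :: (nat \<Rightarrow> bool) \<times> (nat \<Rightarrow> bool). (fst x, \<lambda>j. snd x (Suc (prod_encode (i, j)))))" for i
        by (intro continuous_on_Pair continuous_on_coordinatewise_then_product bit continuous_intros)
      show "gdelta_set (- (\<Union>i. {x :: (nat \<Rightarrow> bool) \<times> (nat \<Rightarrow> bool). snd x (Suc (prod_encode (i, 0)))}))"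
        by (intro cl closed_Compl open_UN ballI clop)
      show "gdelta_set (\<Union>i. {x :: (nat \<Rightarrow> bool) \<times> (nat \<Rightarrow> bool). snd x (Suc (prod_encode (i, 0)))})"
        by (intro opn open_UN ballI clop)
    qed (intro opn clop open_Compl)+
    ultimately show ?thesis
      using c by (intro bexI[of _ c']) (auto simp: c'_def)
  qed
  have gen: "sets cantor = sigma_sets UNIV (range (\<lambda>n. {a. a n}))"
  proof
    let ?N = "sigma UNIV (range (\<lambda>n. {a::nat\<Rightarrow>bool. a n}))"
    have "(\<lambda>a. a) \<in> ?N \<rightarrow>\<^sub>M cantor"
      by (rule measurable_to_cantor) (auto simp: pred_def sets_measure_of)
    then show "sets cantor \<subseteq> sigma_sets UNIV (range (\<lambda>n. {a. a n}))"
      using measurable_sets[of "\<lambda>a. a" ?N cantor] by (auto simp: sets_measure_of)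
    have "{a. a n} \<in> sets cantor" for n :: nat
      using measurable_bit by (simp add: pred_def)
    then show "sigma_sets UNIV (range (\<lambda>n. {a. a n})) \<subseteq> sets cantor"
      by (metis (mono_tags, lifting) image_subsetI sets.sigma_sets_subset space_borel)
  qed
  show ?thesis
    using assms unfolding gen
  proof induction
    case (Basic A)
    then obtain n where A: "A = {a. a n}" by auto
    define c where "c a m = a n" for a :: "nat \<Rightarrow> bool" and m :: nat
    have "c \<in> cantor \<rightarrow>\<^sub>M cantor"
      unfolding c_def by (rule measurable_to_cantor) simp
    moreover have "{(a, c a) | a. True} =
       (\<Inter>m. {x. fst x n} \<inter> {x. snd x m} \<union> - {x. fst x n} \<inter> - {x. snd x m})" (is "_ = ?R")
    proof (intro set_eqI)
      fix x
      have "x = (a, c a) \<longleftrightarrow> a = fst x \<and> (\<forall>m. snd x m = fst x n)" for a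
        by (cases x) (auto simp: c_def fun_eq_iff)
      then show "x \<in> {(a, c a) | a. True} \<longleftrightarrow> x \<in> ?R"
        by auto
    qed
    moreover have "gdelta_set \<dots>"
      by (intro gdelta_INT gdelta_in_Un gdelta_in_Int) (auto intro!: opn clop simp: closed_open[symmetric])
    ultimately show ?case
      using A by (intro bexI[of _ c]) (auto simp: c_def)
  next
    case Empty
    define c where "c a m = False" for a :: "nat \<Rightarrow> bool" and m :: nat
    have "c \<in> cantor \<rightarrow>\<^sub>M cantor"
      unfolding c_def by (rule measurable_to_cantor) simp
    moreover have "{(a, c a) | a. True} = (\<Inter>m. - {x. snd x m})" (is "_ = ?R")
      by (auto simp: c_def fun_eq_iff)
    moreover have "gdelta_set \<dots>"
      by (intro gdelta_INT) (auto intro!: opn clop simp: closed_open[symmetric])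
    moreover have "\<forall>a. c a 0 \<longleftrightarrow> a \<in> {}" by (simp add: c_def)
    ultimately show ?case
      by (intro bexI[of _ c]) simp_all
  next
    case (Compl A)
    then show ?case by (intro compl)
  next
    case (Union A)
    then show ?case by (intro un)
  qed
qed

text \<open>
  The image of the embedding \<open>e\<close> is the Borel set of fixed points of \<open>e \<circ> r\<close>. It is perhaps not
  \<open>G\<^sub>\<delta>\<close>, but becomes so after refining the topology of the Cantor space as above.
\<close>

lemma standard_borel_if_meas_retract_cantor:
  assumes "meas_retract M cantor"
  shows "standard_borel M"
proof -
  obtain e r where e[measurable]: "e \<in> M \<rightarrow>\<^sub>M cantor" and r[measurable]: "r \<in> cantor \<rightarrow>\<^sub>M M"
    and re: "\<forall>x\<in>space M. r (e x) = x"
    using assms by (rule meas_retractE)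
  have img: "e ` space M = {a. e (r a) = a}"
  proof (intro set_eqI iffI)
    fix a assume "a \<in> {a. e (r a) = a}"
    then have "a = e (r a)" "r a \<in> space M" using measurable_space[OF r, of a] by simp_all
    then show "a \<in> e ` space M" by (rule image_eqI)
  next
    fix a assume "a \<in> e ` space M"
    then show "a \<in> {a. e (r a) = a}" using re by auto
  qed
  have [measurable]: "Measurable.pred cantor (\<lambda>a. e (r a) n)" for n
    by (rule measurable_bit_of) measurable
  have "Measurable.pred cantor (\<lambda>a. \<forall>n. e (r a) n = a n)"
    by measurable
  then have E: "e ` space M \<in> sets cantor"
    unfolding img by (simp add: fun_eq_iff pred_def)
  then obtain c where c[measurable]: "c \<in> cantor \<rightarrow>\<^sub>M cantor"
    and G: "gdelta_set {(a, c a) | a. True}" and c0: "\<And>a. c a 0 \<longleftrightarrow> a \<in> e ` space M"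
    using borel_set_gdelta_refinement[OF E] by blast
  define f where "f x = (e x, c (e x))" for x
  show ?thesis
  proof (rule standard_borel_if_gdelta_image)
    show "completely_metrizable_space (euclidean :: ((nat \<Rightarrow> bool) \<times> (nat \<Rightarrow> bool)) topology)"
      using completely_metrizable_cantor
      by (metis completely_metrizable_space_prod_topology prod_topology_euclidean)
    show "inj_on f (space M)"
      by (rule inj_on_inverseI[where g = "\<lambda>p. r (fst p)"]) (simp add: f_def re)
    have "f ` space M = {(a, c a) | a. True} \<inter> {x. snd x 0}"
      using c0 unfolding f_def by (auto simp: image_iff)
    moreover have "gdelta_set {x :: (nat \<Rightarrow> bool) \<times> (nat \<Rightarrow> bool). snd x 0}"
      by (intro open_imp_gdelta_in, unfold open_openin[symmetric], rule continuous_bool_clopen,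
          rule continuous_on_product_then_coordinatewise, intro continuous_intros)
    ultimately show "gdelta_set (f ` space M)" using G by (simp add: gdelta_in_Int)
    have f[measurable]: "f \<in> M \<rightarrow>\<^sub>M borel"
      unfolding f_def borel_prod[symmetric] by measurable
    have "(fst :: _ \<Rightarrow> nat \<Rightarrow> bool) \<in> (borel :: ((nat \<Rightarrow> bool) \<times> (nat \<Rightarrow> bool)) measure) \<rightarrow>\<^sub>M cantor"
      by (intro borel_measurable_continuous_onI continuous_intros)
    then have "(\<lambda>x. r (fst x)) \<in> (borel :: ((nat \<Rightarrow> bool) \<times> (nat \<Rightarrow> bool)) measure) \<rightarrow>\<^sub>M M"
      by (rule measurable_compose[OF _ r])
    then have "(\<lambda>x. r (fst x)) \<circ> f \<in> vimage_algebra (space M) f borel \<rightarrow>\<^sub>M M"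
      by (intro measurable_comp[OF measurable_vimage_algebra1]) auto
    then have "(\<lambda>x. x) \<in> vimage_algebra (space M) f borel \<rightarrow>\<^sub>M M"
      by (rule measurable_cong[THEN iffD1, rotated]) (simp add: f_def re)
    then have "sets M \<subseteq> sets (vimage_algebra (space M) f borel)"
    proof (intro subsetI)
      fix A assume m: "(\<lambda>x. x) \<in> vimage_algebra (space M) f borel \<rightarrow>\<^sub>M M" and A: "A \<in> sets M"
      show "A \<in> sets (vimage_algebra (space M) f borel)"
        using measurable_sets[OF m A] sets.sets_into_space[OF A] by (simp add: Int_absorb2)
    qed
    moreover have "sets (vimage_algebra (space M) f borel) \<subseteq> sets M"
      by (rule sets_image_in_sets) auto
    ultimately show "sets M = sets (vimage_algebra (space M) f borel)" by simp
  qed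
qed

section \<open>Standard Borel spaces are retracts of the Cantor space\<close>


text \<open>
  A point is coded by the sequence \<open>e x\<close> of its memberships in a countable base \<open>U\<close>. The
  predicate \<open>G\<close> describes which sequences \<open>a\<close> occur: the sets \<open>U i\<close> with \<open>a i\<close> form a filter
  base of nonempty sets of arbitrarily small diameter that contains with every set another one
  whose closure lies inside, and it is upward closed. By completeness such a family has a common
  point. Since \<open>G\<close> consists of countably many conditions on bits, it is measurable.
\<close>

lemma meas_retract_cantor_if_standard_borel:
  assumes "standard_borel M" and ne: "space M \<noteq> {}"
  shows "meas_retract M cantor"
proof -
  obtain T where T: "completely_metrizable_space T" "second_countable T" "topspace T = space M"
    and sets: "sets M = sigma_sets (topspace T) {U. openin T U}"
    using assms(1) unfolding standard_borel_def by blast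
  obtain S d where S: "Metric_space S d" "Metric_space.mcomplete S d" "T = Metric_space.mtopology S d"
    using T(1) unfolding completely_metrizable_space_def by blast
  interpret Metric_space S d by (rule S(1))
  have SM: "S = space M" using T(3) S(3) by simp
  obtain B where B0: "countable B" "\<forall>V\<in>B. openin T V"
    "\<forall>U x. openin T U \<and> x \<in> U \<longrightarrow> (\<exists>V\<in>B. x \<in> V \<and> V \<subseteq> U)"
    using T(2) unfolding second_countable_def by blast
  have B: "countable B" "\<And>V. V \<in> B \<Longrightarrow> openin T V"
    "\<And>U x. openin T U \<Longrightarrow> x \<in> U \<Longrightarrow> \<exists>V\<in>B. x \<in> V \<and> V \<subseteq> U"
    using B0 by blast+
  obtain x0 where x0: "x0 \<in> S" using ne SM by auto
  have "B \<noteq> {}" using B(3)[OF openin_topspace, of x0] x0 T(3) SM by auto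
  define U where "U = from_nat_into B"
  have rU: "range U = B" unfolding U_def using B(1) \<open>B \<noteq> {}\<close> by (rule range_from_nat_into[rotated])
  have openU: "openin mtopology (U n)" for n using B(2) rU S(3) by blast
  have US: "U n \<subseteq> S" for n using openin_subset[OF openU] by simp
  have base: "\<exists>n. x \<in> U n \<and> U n \<subseteq> V" if "openin mtopology V" "x \<in> V" for V x
    using B(3)[of V x] that S(3) rU by (metis rangeE)
  have base_ball: "\<exists>n. x \<in> U n \<and> U n \<subseteq> mball x e" if "x \<in> S" "e > 0" for x e
    using base[OF openin_mball, of x x e] that by simp
  define e where "e x n \<longleftrightarrow> x \<in> U n" for x n
  define G where "G a \<longleftrightarrow>
      (\<forall>i j. a i \<and> a j \<longrightarrow> (\<exists>k. a k \<and> U k \<subseteq> U i \<inter> U j)) \<and>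
      (\<forall>i. a i \<longrightarrow> U i \<noteq> {}) \<and>
      (\<forall>n::nat. \<exists>i. a i \<and> (\<exists>c. U i \<subseteq> mcball c (inverse (Suc n)))) \<and>
      (\<forall>i. a i \<longrightarrow> (\<exists>j. a j \<and> mtopology closure_of U j \<subseteq> U i)) \<and>
      (\<forall>i j. U i \<subseteq> U j \<longrightarrow> a i \<longrightarrow> a j)" for a
  have G1: "G (e x)" if x: "x \<in> S" for x
    unfolding G_def e_def
  proof (intro conjI allI impI)
    fix i j assume "x \<in> U i \<and> x \<in> U j"
    then show "\<exists>k. x \<in> U k \<and> U k \<subseteq> U i \<inter> U j"
      by (intro base openin_Int openU) auto
  next
    fix n :: nat
    obtain i where "x \<in> U i" "U i \<subseteq> mball x (inverse (Suc n))"
      using base_ball[OF x, of "inverse (Suc n)"] by auto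
    then show "\<exists>i. x \<in> U i \<and> (\<exists>c. U i \<subseteq> mcball c (inverse (Suc n)))"
      using mball_subset_mcball by blast
  next
    fix i assume "x \<in> U i"
    then obtain r where r: "r > 0" "mball x r \<subseteq> U i"
      using openU[of i] unfolding openin_mtopology by auto
    obtain j where j: "x \<in> U j" "U j \<subseteq> mball x (r / 2)"
      using base_ball[OF x, of "r / 2"] r by auto
    have "mtopology closure_of U j \<subseteq> mcball x (r / 2)"
      using j mball_subset_mcball by (intro closure_of_minimal) auto
    also have "\<dots> \<subseteq> mball x r" using r by (intro mcball_subset_mball_concentric) auto
    finally show "\<exists>j. x \<in> U j \<and> mtopology closure_of U j \<subseteq> U i" using j r by blast
  qed auto
  \<comment> \<open>Completeness enters here: the closures of the selected base sets have a common point.\<close>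
  have G2: "\<exists>x\<in>S. a = e x" if a: "G a" for a
  proof -
    have a1: "\<exists>k. a k \<and> U k \<subseteq> U i \<inter> U j" if "a i" "a j" for i j
      using a that unfolding G_def by blast
    have a2: "U i \<noteq> {}" if "a i" for i using a that unfolding G_def by blast
    have a3: "\<exists>i c. a i \<and> U i \<subseteq> mcball c (inverse (Suc n))" for n
      using a unfolding G_def by blast
    have a4: "\<exists>j. a j \<and> mtopology closure_of U j \<subseteq> U i" if "a i" for i
      using a that unfolding G_def by blast
    have a5: "a j" if "a i" "U i \<subseteq> U j" for i j using a that unfolding G_def by blast
    have small: "\<exists>i c. a i \<and> mtopology closure_of U i \<subseteq> mcball c r" if r: "r > 0" for r
    proof -
      obtain n where n: "inverse (Suc n) < r" using reals_Archimedean[OF r] by auto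
      obtain i c where i: "a i" "U i \<subseteq> mcball c (inverse (Suc n))" using a3 by blast
      then have "U i \<subseteq> mcball c r"
        using mcball_subset_concentric[of "inverse (Suc n)" r c] n by (meson less_imp_le order_trans)
      then have "mtopology closure_of U i \<subseteq> mcball c r" by (intro closure_of_minimal) auto
      with i show ?thesis by blast
    qed
    define C where "C = {mtopology closure_of U i | i. a i}"
    have fin: "\<exists>k. a k \<and> U k \<subseteq> \<Inter>F" if "finite F" "F \<subseteq> C" for F
      using that
    proof (induction F)
      case empty
      then show ?case using a3 by blast
    next
      case (insert X F)
      obtain k where k: "a k" "U k \<subseteq> \<Inter>F" using insert by blast
      obtain i where i: "a i" "X = mtopology closure_of U i"
        using insert.prems unfolding C_def by blast
      obtain l where l: "a l" "U l \<subseteq> U k \<inter> U i" using a1 k i by blast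
      have "U i \<subseteq> X" unfolding i using US by (intro closure_of_subset) auto
      then show ?case using k l by blast
    qed
    have "\<Inter>C \<noteq> {}"
    proof (rule S(2)[unfolded mcomplete_fip, rule_format], intro conjI ballI allI impI)
      show "closedin mtopology X" if "X \<in> C" for X using that unfolding C_def by auto
      show "\<exists>X c. X \<in> C \<and> X \<subseteq> mcball c r" if "r > 0" for r
        using small[OF that] unfolding C_def by blast
      show "\<Inter>F \<noteq> {}" if "finite F \<and> F \<subseteq> C" for F
        using fin[of F] a2 that by blast
    qed
    then obtain x where "x \<in> \<Inter>C" by blast
    then have x: "x \<in> mtopology closure_of U i" if "a i" for i using that unfolding C_def by blast
    have xU: "x \<in> U i" if "a i" for i using a4[OF that] x by blast
    have xS: "x \<in> S" using a3 xU US by blast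
    have "a i" if xi: "x \<in> U i" for i
    proof -
      obtain r where r: "r > 0" "mball x r \<subseteq> U i"
        using openU[of i] xi unfolding openin_mtopology by auto
      obtain j c where j: "a j" "mtopology closure_of U j \<subseteq> mcball c (r / 3)"
        using small[of "r / 3"] r by auto
      have "U j \<subseteq> mball x r"
      proof
        fix y assume y: "y \<in> U j"
        have "U j \<subseteq> mcball c (r / 3)"
          using j closure_of_subset[of "U j" mtopology] US by auto
        then have "d c x \<le> r / 3" "d c y \<le> r / 3" "c \<in> S"
          using y xU[OF j(1)] by auto
        moreover have "y \<in> S" using y US by auto
        moreover have "d x y \<le> d x c + d c y" using xS \<open>y \<in> S\<close> \<open>c \<in> S\<close> by (intro triangle) auto
        ultimately show "y \<in> mball x r" using xS r by (auto simp: commute)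
      qed
      then show ?thesis using a5[OF j(1)] r by blast
    qed
    then have "a = e x" using xU unfolding e_def by (auto simp: fun_eq_iff)
    then show ?thesis using xS by blast
  qed
  have inj: "x = y" if xy: "x \<in> S" "y \<in> S" "e x = e y" for x y
  proof (rule ccontr)
    assume "x \<noteq> y"
    then have "d x y > 0" using xy by simp
    then obtain n where "x \<in> U n" "U n \<subseteq> mball x (d x y)"
      using base_ball[OF xy(1), of "d x y"] by blast
    moreover have "y \<notin> mball x (d x y)" by simp
    ultimately show False using xy(3) unfolding e_def by (metis subsetD)
  qed
  define r where "r a = (if G a then SOME x. x \<in> S \<and> a = e x else x0)" for a
  have r1: "r a \<in> S \<and> a = e (r a)" if "G a" for a
    using someI_ex[of "\<lambda>x. x \<in> S \<and> a = e x"] G2[OF that] that unfolding r_def by auto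
  have re: "r (e x) = x" if "x \<in> S" for x
    using r1[OF G1[OF that]] inj that by metis
  have "Measurable.pred cantor G"
    unfolding G_def by measurable
  note this[measurable]
  have gen: "sets M = sigma_sets (space M) B"
  proof
    have "U \<in> sigma_sets (space M) B" if U: "openin T U" for U
    proof -
      have "U = \<Union>{V\<in>B. V \<subseteq> U}" using B(3)[OF U] by blast
      moreover have "\<Union>{V\<in>B. V \<subseteq> U} \<in> sigma_sets (space M) B"
        using B(1) by (intro sigma_sets_UNION) (auto intro: countable_subset[OF _ B(1)])
      ultimately show ?thesis by simp
    qed
    then show "sets M \<subseteq> sigma_sets (space M) B"
      unfolding sets T(3) by (intro sigma_sets_mono) auto
    show "sigma_sets (space M) B \<subseteq> sets M"
      unfolding sets T(3) using B(2) by (intro sigma_sets_mono) auto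
  qed
  have "e \<in> M \<rightarrow>\<^sub>M cantor"
  proof (rule measurable_to_cantor)
    fix n
    have "U n \<in> sets M" unfolding gen using rU by auto
    then show "Measurable.pred M (\<lambda>x. e x n)" unfolding e_def by measurable
  qed
  moreover have "r \<in> cantor \<rightarrow>\<^sub>M M"
  proof (rule measurable_sigma_sets[OF gen])
    show "B \<subseteq> Pow (space M)" using US rU SM by auto
    show "r \<in> space cantor \<rightarrow> space M" using r1 x0 SM by (auto simp: r_def)
    fix V assume "V \<in> B"
    then obtain n where n: "V = U n" using rU by auto
    have "r a \<in> U n \<longleftrightarrow> (if G a then a n else x0 \<in> U n)" for a
    proof (cases "G a")
      case True
      then show ?thesis using r1[OF True] unfolding e_def by metis
    qed (simp add: r_def)
    then have "r -` V \<inter> space cantor = {a. if G a then a n else x0 \<in> U n}" unfolding n by auto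
    also have "\<dots> \<in> sets cantor" by measurable
    finally show "r -` V \<inter> space cantor \<in> sets cantor" .
  qed
  ultimately show ?thesis unfolding meas_retract_def using re SM by blast
qed

theorem standard_borel_iff_meas_retract_cantor:
  "standard_borel M \<longleftrightarrow> space M = {} \<or> meas_retract M cantor"
proof -
  have "standard_borel M" if "space M = {}"
  proof -
    have "sets M = {{}}" using that by (simp add: space_empty_iff)
    moreover have "Collect (openin trivial_topology) = {{}::'a set}" by auto
    moreover have "sigma_sets {} {{}} = {{}::'a set}"
      using sigma_algebra.sigma_sets_eq[OF sigma_algebra_trivial[of "{}::'a set"]] by simp
    ultimately show ?thesis
      unfolding standard_borel_def using that
      by (intro exI[of _ "discrete_topology {}"] conjI)
         (simp_all add: completely_metrizable_space_discrete_topology second_countable_discrete_topology)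
  qed
  then show ?thesis
    using meas_retract_cantor_if_standard_borel standard_borel_if_meas_retract_cantor by blast
qed


section \<open>Cylinders\<close>

text \<open>
  The first \<open>n\<close> bits with the most recent bit in front, so that extending a prefix by one bit is
  \<^const>\<open>Cons\<close> and induction over bit lists is induction over the length of the prefix.
\<close>

primrec rev_prefix :: "(nat \<Rightarrow> bool) \<Rightarrow> nat \<Rightarrow> bool list" where
  "rev_prefix a 0 = []"
| "rev_prefix a (Suc n) = a n # rev_prefix a n"

definition cyl :: "bool list \<Rightarrow> (nat \<Rightarrow> bool) set" where
  "cyl l = {a. rev_prefix a (length l) = l}"

lemma length_rev_prefix [simp]: "length (rev_prefix a n) = n"
  by (induction n) auto

lemma cyl_Nil [simp]: "cyl [] = UNIV"
  by (simp add: cyl_def)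

lemma mem_cyl_Cons: "a \<in> cyl (b # l) \<longleftrightarrow> a (length l) = b \<and> a \<in> cyl l"
  by (auto simp: cyl_def)

lemma mem_cyl_rev_prefix [simp]: "a \<in> cyl (rev_prefix a n)"
  by (simp add: cyl_def)

lemma mem_cyl_iff: "length l = n \<Longrightarrow> a \<in> cyl l \<longleftrightarrow> rev_prefix a n = l"
  by (auto simp: cyl_def)

lemma cyl_split: "cyl l = cyl (True # l) \<union> cyl (False # l)" "cyl (True # l) \<inter> cyl (False # l) = {}"
  by (auto simp: mem_cyl_Cons)

lemma drop_rev_prefix: "n \<le> m \<Longrightarrow> drop (m - n) (rev_prefix a m) = rev_prefix a n"
  by (induction m) (auto simp: Suc_diff_le le_Suc_eq)

lemma cyl_Int: "length l \<le> length m \<Longrightarrow> cyl l \<inter> cyl m = (if drop (length m - length l) m = l then cyl m else {})"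
  using drop_rev_prefix[of "length l" "length m"] by (auto simp: cyl_def) metis+

lemma Int_stable_cyl: "Int_stable (insert {} (range cyl))"
proof (rule Int_stableI)
  have "cyl l \<inter> cyl m \<in> insert {} (range cyl)" if "length l \<le> length m" for l m
    unfolding cyl_Int[OF that] by auto
  then have "cyl l \<inter> cyl m \<in> insert {} (range cyl)" for l m
    by (metis Int_commute nat_le_linear)
  then show "A \<inter> B \<in> insert {} (range cyl)"
    if "A \<in> insert {} (range cyl)" "B \<in> insert {} (range cyl)" for A B
    using that by auto
qed

lemma cyl_sets [measurable, simp]: "cyl l \<in> sets cantor"
proof (induction l)
  case (Cons b l)
  have "cyl (b # l) = {a. a (length l) = b} \<inter> cyl l" by (auto simp: mem_cyl_Cons)
  also have "\<dots> \<in> sets cantor" by (intro sets.Int Cons.IH) measurable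
  finally show ?case .
qed simp

lemma measurable_rev_prefix [measurable]: "(\<lambda>a. rev_prefix a n) \<in> cantor \<rightarrow>\<^sub>M count_space UNIV"
proof (subst measurable_count_space_eq2_countable, intro conjI ballI)
  fix l
  have "(\<lambda>a. rev_prefix a n) -` {l} \<inter> space cantor = (if length l = n then cyl l else {})"
    by (auto simp: cyl_def)
  then show "(\<lambda>a. rev_prefix a n) -` {l} \<inter> space cantor \<in> sets cantor" by simp
qed auto

lemma sets_cantor_eq: "sets cantor = sigma_sets UNIV (insert {} (range cyl))"
proof
  let ?S = "sigma_sets UNIV (insert {} (range cyl))"
  let ?N = "sigma UNIV (insert {} (range cyl))"
  have N: "sets ?N = ?S" "space ?N = UNIV" by (auto simp: sets_measure_of space_measure_of)
  have "(\<lambda>a. a) \<in> ?N \<rightarrow>\<^sub>M cantor"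
  proof (rule measurable_to_cantor)
    fix n
    have "{a. a n} = (\<Union>l\<in>{l. length l = n}. cyl (True # l))"
      by (auto simp: mem_cyl_Cons) (metis length_rev_prefix mem_cyl_rev_prefix)
    also have "\<dots> \<in> sets ?N"
      by (intro sets.countable_UN'') (auto simp: N intro: sigma_sets.Basic)
    finally show "Measurable.pred ?N (\<lambda>a. a n)" by (simp add: pred_def N)
  qed
  then show "sets cantor \<subseteq> ?S"
    using measurable_sets[of "\<lambda>a. a" ?N cantor] by (auto simp: N)
  show "?S \<subseteq> sets cantor"
  proof -
    have "insert {} (range cyl) \<subseteq> sets cantor" using cyl_sets by blast
    from sets.sigma_sets_subset[OF this] show ?thesis by simp
  qed
qed

lemma prob_cantor_eqI:
  assumes "M \<in> space (prob_algebra cantor)" "N \<in> space (prob_algebra cantor)"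
    and "\<And>l. measure M (cyl l) = measure N (cyl l)"
  shows "M = N"
proof (rule measure_eqI_generator_eq[OF Int_stable_cyl, where A = "\<lambda>_. UNIV"])
  interpret M: prob_space M using assms(1) by (simp add: space_prob_algebra)
  interpret N: prob_space N using assms(2) by (simp add: space_prob_algebra)
  show "emeasure M X = emeasure N X" if "X \<in> insert {} (range cyl)" for X
    using that assms(3) by (auto simp: M.emeasure_eq_measure N.emeasure_eq_measure)
  show "sets M = sigma_sets UNIV (insert {} (range cyl))" "sets N = sigma_sets UNIV (insert {} (range cyl))"
    using assms(1,2) by (simp_all add: space_prob_algebra sets_cantor_eq)
  show "range (\<lambda>_::nat. UNIV) \<subseteq> insert {} (range cyl)" using cyl_Nil by blast
  show "emeasure M UNIV \<noteq> \<infinity>" by simp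
qed auto

section \<open>Probability measures on the Cantor space\<close>

text \<open>
  These are exactly the systems of probabilities of all cylinders under some probability measure.
\<close>

definition cyl_weight :: "(bool list \<Rightarrow> real) \<Rightarrow> bool" where
  "cyl_weight w \<longleftrightarrow> w [] = 1 \<and> (\<forall>l. 0 \<le> w l \<and> w l = w (True # l) + w (False # l))"

lemma cyl_weight_measure:
  assumes "p \<in> space (prob_algebra cantor)"
  shows "cyl_weight (\<lambda>l. measure p (cyl l))"
proof -
  interpret prob_space p using assms by (simp add: space_prob_algebra)
  have s: "sets p = sets cantor" using assms by (simp add: space_prob_algebra)
  have "measure p (cyl l) = measure p (cyl (True # l)) + measure p (cyl (False # l))" for l
    using finite_measure_Union[of "cyl (True # l)" "cyl (False # l)"] cyl_split[of l] s by simp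
  moreover have "measure p UNIV = 1"
    using prob_space sets_eq_imp_space_eq[OF s] by simp
  ultimately show ?thesis unfolding cyl_weight_def cyl_Nil using measure_nonneg by blast
qed

text \<open>
  Instead of extending a content, push Lebesgue measure on the unit interval forward. Every bit
  list \<open>l\<close> is assigned the half-open interval of length \<open>w l\<close> that starts at \<open>lo l\<close>; the
  intervals of the two extensions of \<open>l\<close> partition that of \<open>l\<close>. Following the intervals around a
  point \<open>u\<close> yields a sequence \<open>bits u\<close>, which lies in \<open>cyl l\<close> iff \<open>u\<close> lies in the interval of \<open>l\<close>.
\<close>

lemma ex_prob_of_cyl_weight:
  assumes w: "cyl_weight w"
  shows "\<exists>p\<in>space (prob_algebra cantor). \<forall>l. measure p (cyl l) = w l"
proof -
  have w1: "w [] = 1" and w0: "\<And>l. 0 \<le> w l" and ws: "\<And>l. w l = w (True # l) + w (False # l)"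
    using w unfolding cyl_weight_def by blast+
  define lo where "lo = rec_list (0::real) (\<lambda>b l x. if b then x + w (False # l) else x)"
  have lo: "lo [] = 0" "lo (b # l) = (if b then lo l + w (False # l) else lo l)" for b l
    unfolding lo_def by auto
  define path where "path u = rec_nat [] (\<lambda>_ l. (u \<ge> lo l + w (False # l)) # l)" for u
  have path: "path u 0 = []" "path u (Suc n) = (u \<ge> lo (path u n) + w (False # path u n)) # path u n" for u n
    unfolding path_def by auto
  define bits where "bits u n = (u \<ge> lo (path u n) + w (False # path u n))" for u n
  have prefix_bits: "rev_prefix (bits u) n = path u n" for u n
    by (induction n) (auto simp: path bits_def)
  have lo_bounds: "0 \<le> lo l \<and> lo l + w l \<le> 1" for l
  proof (induction l)
    case (Cons b l)
    then show ?case using ws[of l] w0[of "True # l"] w0[of "False # l"] by (auto simp: lo)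
  qed (simp add: lo w1)
  have bits_cyl: "bits u \<in> cyl l \<longleftrightarrow> lo l \<le> u \<and> u < lo l + w l" if u: "0 \<le> u" "u < 1" for u l
  proof (induction l)
    case Nil
    then show ?case using u by (simp add: lo w1)
  next
    case (Cons b l)
    have "bits u \<in> cyl (b # l) \<longleftrightarrow> bits u (length l) = b \<and> bits u \<in> cyl l" by (rule mem_cyl_Cons)
    also have "\<dots> \<longleftrightarrow> (u \<ge> lo l + w (False # l)) = b \<and> bits u \<in> cyl l"
      by (auto simp: bits_def cyl_def prefix_bits)
    also have "\<dots> \<longleftrightarrow> (u \<ge> lo l + w (False # l)) = b \<and> lo l \<le> u \<and> u < lo l + w l"
      unfolding Cons ..
    also have "\<dots> \<longleftrightarrow> lo (b # l) \<le> u \<and> u < lo (b # l) + w (b # l)"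
      using ws[of l] w0[of "True # l"] w0[of "False # l"] by (auto simp: lo)
    finally show ?case .
  qed
  define L where "L = restrict_space lborel {0..<1::real}"
  have L: "prob_space L"
    by (rule prob_spaceI) (simp add: L_def emeasure_restrict_space space_restrict_space)
  have sp: "space L = {0..<1}" by (simp add: L_def space_restrict_space)
  have vim: "bits -` cyl l \<inter> space L = {lo l..<lo l + w l}" for l
    using bits_cyl lo_bounds[of l] by (auto simp: sp)
  have meas: "bits \<in> L \<rightarrow>\<^sub>M cantor"
  proof (rule measurable_sigma_sets[OF sets_cantor_eq])
    fix A assume "A \<in> insert {} (range cyl)"
    then show "bits -` A \<inter> space L \<in> sets L"
    proof
      assume "A \<in> range cyl"
      then obtain l where l: "A = cyl l" by auto
      show ?thesis unfolding l vim using lo_bounds[of l]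
        by (auto simp: L_def sets_restrict_space image_iff intro!: bexI[of _ "{lo l..<lo l + w l}"])
    qed simp
  qed auto
  show ?thesis
  proof (intro bexI[of _ "distr L cantor bits"] allI)
    show "distr L cantor bits \<in> space (prob_algebra cantor)"
      using prob_space.prob_space_distr[OF L meas] by (simp add: space_prob_algebra)
    fix l
    have "measure (distr L cantor bits) (cyl l) = measure L {lo l..<lo l + w l}"
      by (simp add: measure_distr[OF meas] vim)
    also have "\<dots> = measure lborel {lo l..<lo l + w l}"
      unfolding L_def using lo_bounds[of l] by (intro measure_restrict_space) auto
    also have "\<dots> = w l" using w0[of l] by simp
    finally show "measure (distr L cantor bits) (cyl l) = w l" .
  qed
qed

text \<open>
  Inverse of the passage from measures to weights, extended by an arbitrary point mass so that it
  is total and can serve as a retraction.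
\<close>

definition prob_of_weight :: "(bool list \<Rightarrow> real) \<Rightarrow> (nat \<Rightarrow> bool) measure" where
  "prob_of_weight w = (if cyl_weight w
     then SOME p. p \<in> space (prob_algebra cantor) \<and> (\<forall>l. measure p (cyl l) = w l)
     else return cantor (\<lambda>_. False))"

lemma prob_of_weight_space: "prob_of_weight w \<in> space (prob_algebra cantor)"
  and measure_prob_of_weight: "cyl_weight w \<Longrightarrow> measure (prob_of_weight w) (cyl l) = w l"
proof -
  have *: "prob_of_weight w \<in> space (prob_algebra cantor) \<and> (\<forall>l. measure (prob_of_weight w) (cyl l) = w l)"
    if "cyl_weight w"
    using ex_prob_of_cyl_weight[OF that] that
      someI_ex[of "\<lambda>p. p \<in> space (prob_algebra cantor) \<and> (\<forall>l. measure p (cyl l) = w l)"]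
    unfolding prob_of_weight_def by auto
  show "prob_of_weight w \<in> space (prob_algebra cantor)"
    using * by (cases "cyl_weight w")
      (auto simp: prob_of_weight_def space_prob_algebra intro!: prob_space_return)
  show "cyl_weight w \<Longrightarrow> measure (prob_of_weight w) (cyl l) = w l"
    using * by auto
qed

lemma measurable_prob_of_weight [measurable]: "prob_of_weight \<in> borel \<rightarrow>\<^sub>M prob_algebra cantor"
proof (rule measurable_prob_algebra_generated[OF sets_cantor_eq Int_stable_cyl])
  show "prob_space (prob_of_weight w)" "sets (prob_of_weight w) = sets cantor" for w
    using prob_of_weight_space[of w] by (auto simp: space_prob_algebra)
  fix A assume A: "A \<in> insert {} (range cyl)"
  have w[measurable]: "(\<lambda>w. w l) \<in> borel_measurable (borel :: (bool list \<Rightarrow> real) measure)" for l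
    by (rule measurable_product_coordinates)
  have "Measurable.pred (borel :: (bool list \<Rightarrow> real) measure) (\<lambda>w. w [] = 1)"
    "Measurable.pred (borel :: (bool list \<Rightarrow> real) measure) (\<lambda>w. 0 \<le> w l)"
    "Measurable.pred (borel :: (bool list \<Rightarrow> real) measure) (\<lambda>w. w l = w (True # l) + w (False # l))" for l
    unfolding pred_def by (intro borel_measurable_eq borel_measurable_le borel_measurable_add borel_measurable_const w)+
  then have [measurable]: "Measurable.pred borel cyl_weight"
    unfolding cyl_weight_def by (intro pred_intros_logic pred_intros_countable)
  have "(\<lambda>w. emeasure (prob_of_weight w) (cyl l)) \<in> borel_measurable borel" for l
  proof -
    have "emeasure (prob_of_weight w) (cyl l) =
       (if cyl_weight w then ennreal (w l) else emeasure (return cantor (\<lambda>_. False)) (cyl l))" for w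
    proof (cases "cyl_weight w")
      case True
      interpret prob_space "prob_of_weight w"
        using prob_of_weight_space[of w] by (simp add: space_prob_algebra)
      show ?thesis using True measure_prob_of_weight[OF True, of l] by (simp add: emeasure_eq_measure)
    qed (simp add: prob_of_weight_def)
    then show ?thesis by (subst measurable_cong) auto
  qed
  with A show "(\<lambda>w. emeasure (prob_of_weight w) A) \<in> borel_measurable borel" by auto
qed auto

lemma standard_borel_borel: "standard_borel (borel :: 'a::polish_space measure)"
proof -
  obtain B :: "'a set set" where B: "countable B" "\<forall>V\<in>B. open V"
    "\<forall>U. open U \<longrightarrow> (\<exists>B'. B' \<subseteq> B \<and> U = \<Union>B')"
    using univ_second_countable by (metis (no_types))
  have "second_countable (euclidean :: 'a topology)"
    unfolding second_countable_def
  proof (intro exI[of _ B] conjI allI impI)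
    fix U x assume "openin euclidean U \<and> (x::'a) \<in> U"
    then show "\<exists>V\<in>B. x \<in> V \<and> V \<subseteq> U" using B(3) by (metis UnionE Union_upper open_openin subsetD)
  qed (use B in auto)
  then show ?thesis
    unfolding standard_borel_def
    by (intro exI[of _ euclidean]) (auto simp: completely_metrizable_space_euclidean sets_borel)
qed

text \<open>
  The weights live in a countable power of the reals, which is Polish and therefore itself a
  retract of the Cantor space.
\<close>

lemma meas_retract_prob_cantor: "meas_retract (prob_algebra cantor) cantor"
proof -
  let ?W = "borel :: (bool list \<Rightarrow> real) measure"
  have "meas_retract (prob_algebra cantor) ?W"
    unfolding meas_retract_def
  proof (intro exI conjI ballI)
    show "(\<lambda>p l. measure p (cyl l)) \<in> prob_algebra cantor \<rightarrow>\<^sub>M ?W"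
      by (rule measurable_coordinatewise_then_product) measurable
    show "prob_of_weight \<in> ?W \<rightarrow>\<^sub>M prob_algebra cantor" by measurable
    show "prob_of_weight (\<lambda>l. measure p (cyl l)) = p" if "p \<in> space (prob_algebra cantor)" for p
      using that cyl_weight_measure[OF that]
      by (intro prob_cantor_eqI prob_of_weight_space) (auto simp: measure_prob_of_weight)
  qed
  moreover have "meas_retract ?W cantor"
    by (intro meas_retract_cantor_if_standard_borel standard_borel_borel) simp
  ultimately show ?thesis by (rule meas_retract_trans)
qed

text \<open>The empty space has to be treated apart, since it is not a retract of the Cantor space.\<close>

lemma space_prob_algebra_empty:
  assumes "space M = {}"
  shows "space (prob_algebra M) = {}"
proof (intro equals0I)
  fix p assume p: "p \<in> space (prob_algebra M)"
  then have "space p \<noteq> {}" by (intro prob_space.not_empty) (simp add: space_prob_algebra)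
  moreover have "space p = space M" using p by (intro sets_eq_imp_space_eq) (simp add: space_prob_algebra)
  ultimately show False using assms by simp
qed

theorem standard_borel_prob_algebra:
  assumes "standard_borel M"
  shows "standard_borel (prob_algebra M)"
proof (cases "space M = {}")
  case True
  then have "space (prob_algebra M) = {}" by (rule space_prob_algebra_empty)
  then show ?thesis by (simp add: standard_borel_iff_meas_retract_cantor)
next
  case False
  then have "meas_retract (prob_algebra M) (prob_algebra cantor)"
    using assms by (intro meas_retract_prob_algebra meas_retract_cantor_if_standard_borel)
  then have "meas_retract (prob_algebra M) cantor"
    using meas_retract_prob_cantor by (rule meas_retract_trans)
  then show ?thesis by (simp add: standard_borel_iff_meas_retract_cantor)
qed


section \<open>Conditional distributions on the Cantor space\<close>

text \<open>
  Let \<open>P\<close> be a law of a pair \<open>(x, y)\<close> of points of the Cantor space. The conditional probability of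
  \<open>x \<in> cyl l\<close> given the first \<open>n\<close> bits of \<open>y\<close> is an elementary quotient, \<open>ratio P l n y\<close>. As \<open>n\<close> grows it is
  a martingale with values in the unit interval, so its second moments \<open>energy P l n\<close> increase to a
  limit and their increments are the squared distances in \<open>L\<^sup>2\<close>. A subsequence along which the energy
  converges fast enough thus converges almost everywhere. The subsequence may depend on \<open>P\<close>, but has
  to do so measurably, and this is easy because the energies are finite sums of quotients of
  probabilities.
\<close>

abbreviation cantor2 :: "((nat \<Rightarrow> bool) \<times> (nat \<Rightarrow> bool)) measure" where
  "cantor2 \<equiv> cantor \<Otimes>\<^sub>M cantor"

abbreviation snd_law :: "((nat \<Rightarrow> bool) \<times> (nat \<Rightarrow> bool)) measure \<Rightarrow> (nat \<Rightarrow> bool) measure" where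
  "snd_law P \<equiv> distr P cantor snd"

definition rect :: "((nat \<Rightarrow> bool) \<times> (nat \<Rightarrow> bool)) measure \<Rightarrow> bool list \<Rightarrow> bool list \<Rightarrow> real" where
  "rect P l m = measure P (cyl l \<times> cyl m)"

definition ratio :: "((nat \<Rightarrow> bool) \<times> (nat \<Rightarrow> bool)) measure \<Rightarrow> bool list \<Rightarrow> nat \<Rightarrow> (nat \<Rightarrow> bool) \<Rightarrow> real" where
  "ratio P l n y = rect P l (rev_prefix y n) / rect P [] (rev_prefix y n)"

definition energy :: "((nat \<Rightarrow> bool) \<times> (nat \<Rightarrow> bool)) measure \<Rightarrow> bool list \<Rightarrow> nat \<Rightarrow> real" where
  "energy P l n = (\<Sum>m | length m = n. rect P l m * (rect P l m / rect P [] m))"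

text \<open>
  The \<open>j\<close>-th member of the subsequence. It controls the bit lists up to position \<open>j\<close> in a fixed enumeration,
  so that one subsequence serves all of them in the end; this is why the limits inherit the additivity
  of the ratios everywhere they exist. The bound \<open>(1 / 4) ^ j\<close> on squared distances makes the
  distances in \<open>L\<^sup>1\<close> summable.
\<close>

definition level :: "((nat \<Rightarrow> bool) \<times> (nat \<Rightarrow> bool)) measure \<Rightarrow> nat \<Rightarrow> nat" where
  "level P j = (LEAST n. j \<le> n \<and>
     (\<forall>i\<le>j. \<forall>n'\<ge>n. energy P (from_nat i) n' - energy P (from_nat i) n \<le> (1 / 4) ^ j))"

definition limit_weight :: "((nat \<Rightarrow> bool) \<times> (nat \<Rightarrow> bool)) measure \<Rightarrow> (nat \<Rightarrow> bool) \<Rightarrow> bool list \<Rightarrow> real" where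
  "limit_weight P y l = lim (\<lambda>j. ratio P l (level P j) y)"

lemma finite_lists_of_length [simp]: "finite {m :: bool list. length m = n}"
  using finite_lists_length_eq[of "UNIV :: bool set" n] by simp

lemma sum_lists_Suc:
  fixes F :: "bool list \<Rightarrow> real"
  shows "(\<Sum>m | length m = Suc n. F m) = (\<Sum>m | length m = n. F (True # m) + F (False # m))"
proof -
  have e: "{m. length m = Suc n} = Cons True ` {m. length m = n} \<union> Cons False ` {m. length m = n}"
    by (auto simp: length_Suc_conv image_iff)
  have "(\<Sum>m | length m = Suc n. F m) =
      sum F (Cons True ` {m. length m = n}) + sum F (Cons False ` {m. length m = n})"
    unfolding e by (intro sum.union_disjoint) auto
  also have "\<dots> = (\<Sum>m | length m = n. F (True # m)) + (\<Sum>m | length m = n. F (False # m))"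
    by (simp add: sum.reindex comp_def)
  finally show ?thesis by (simp add: sum.distrib)
qed

lemma Times_cyl_sets [measurable, simp]: "cyl l \<times> cyl m \<in> sets cantor2"
  by (intro pair_measureI cyl_sets)

lemma measurable_rect [measurable]: "(\<lambda>P. rect P l m) \<in> borel_measurable (prob_algebra cantor2)"
  unfolding rect_def by (rule measurable_measure_prob_algebra) simp

lemma measurable_ratio:
  "(\<lambda>x. ratio (fst x) l n (snd x)) \<in> borel_measurable (prob_algebra cantor2 \<Otimes>\<^sub>M cantor)"
proof -
  have [measurable]: "(\<lambda>x. rect (fst x) l m) \<in> borel_measurable (prob_algebra cantor2 \<Otimes>\<^sub>M cantor)" for l m
    using measurable_compose[OF measurable_fst measurable_rect] .
  have "(\<lambda>x. rev_prefix (snd x) n) \<in> prob_algebra cantor2 \<Otimes>\<^sub>M cantor \<rightarrow>\<^sub>M count_space UNIV"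
    using measurable_compose[OF measurable_snd measurable_rev_prefix] .
  then show ?thesis
    unfolding ratio_def
    by (intro measurable_compose_countable[where
          f = "\<lambda>m x. rect (fst x) l m / rect (fst x) [] m" and g = "\<lambda>x. rev_prefix (snd x) n"]) auto
qed

lemma measurable_energy [measurable]: "(\<lambda>P. energy P l n) \<in> borel_measurable (prob_algebra cantor2)"
  unfolding energy_def by measurable

lemma measurable_level [measurable]: "(\<lambda>P. level P j) \<in> prob_algebra cantor2 \<rightarrow>\<^sub>M count_space UNIV"
  unfolding level_def by measurable

lemma measurable_limit_weight:
  "(\<lambda>x. limit_weight (fst x) (snd x)) \<in> prob_algebra cantor2 \<Otimes>\<^sub>M cantor \<rightarrow>\<^sub>M borel"
proof (rule measurable_coordinatewise_then_product)
  fix l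
  have "(\<lambda>x. ratio (fst x) l (level (fst x) j) (snd x)) \<in> borel_measurable (prob_algebra cantor2 \<Otimes>\<^sub>M cantor)" for j
    by (rule measurable_compose_countable[OF measurable_ratio
          measurable_compose[OF measurable_fst measurable_level]])
  then show "(\<lambda>x. limit_weight (fst x) (snd x) l) \<in> borel_measurable (prob_algebra cantor2 \<Otimes>\<^sub>M cantor)"
    unfolding limit_weight_def by (rule borel_measurable_lim_metric)
qed

locale cantor2_prob = prob_space P
  for P :: "((nat \<Rightarrow> bool) \<times> (nat \<Rightarrow> bool)) measure" +
  assumes sets_P [measurable_cong, simp]: "sets P = sets cantor2"
begin

lemma in_prob_algebra: "P \<in> space (prob_algebra cantor2)"
  by (simp add: space_prob_algebra prob_space_axioms)

sublocale N: prob_space "snd_law P"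
  by (rule prob_space_distr) measurable

lemma rect_nonneg: "0 \<le> rect P l m"
  by (simp add: rect_def)

lemma rect_le: "rect P l m \<le> rect P [] m"
  unfolding rect_def by (intro finite_measure_mono) auto

lemma rect_snd_law: "rect P [] m = measure (snd_law P) (cyl m)"
proof -
  have "snd -` cyl m \<inter> space P = UNIV \<times> cyl m"
    using sets_eq_imp_space_eq[OF sets_P] by (auto simp: space_pair_measure)
  then show ?thesis by (simp add: rect_def measure_distr)
qed

lemma rect_split1: "rect P l m = rect P (True # l) m + rect P (False # l) m"
proof -
  have "cyl l \<times> cyl m = cyl (True # l) \<times> cyl m \<union> cyl (False # l) \<times> cyl m" using cyl_split(1)[of l] by blast
  moreover have "(cyl (True # l) \<times> cyl m) \<inter> (cyl (False # l) \<times> cyl m) = {}" using cyl_split(2)[of l] by blast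
  ultimately show ?thesis
    unfolding rect_def using finite_measure_Union[of "cyl (True # l) \<times> cyl m" "cyl (False # l) \<times> cyl m"] by simp
qed

lemma rect_split2: "rect P l m = rect P l (True # m) + rect P l (False # m)"
proof -
  have "cyl l \<times> cyl m = cyl l \<times> cyl (True # m) \<union> cyl l \<times> cyl (False # m)" using cyl_split(1)[of m] by blast
  moreover have "(cyl l \<times> cyl (True # m)) \<inter> (cyl l \<times> cyl (False # m)) = {}" using cyl_split(2)[of m] by blast
  ultimately show ?thesis
    unfolding rect_def using finite_measure_Union[of "cyl l \<times> cyl (True # m)" "cyl l \<times> cyl (False # m)"] by simp
qed

lemma ratio_bounds: "0 \<le> ratio P l n y" "ratio P l n y \<le> 1"
proof -
  show "0 \<le> ratio P l n y" by (simp add: ratio_def rect_nonneg)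
  show "ratio P l n y \<le> 1"
    using rect_le[of l "rev_prefix y n"] rect_nonneg[of "[]" "rev_prefix y n"]
    by (cases "rect P [] (rev_prefix y n) = 0") (simp_all add: ratio_def)
qed

lemma measurable_ratio_snd [measurable]: "ratio P l n \<in> borel_measurable cantor"
  using measurable_compose[OF measurable_Pair1'[OF in_prob_algebra, of cantor] measurable_ratio[of l n]] by simp

lemma integral_rev_prefix:
  "(\<integral>y. H (rev_prefix y n) \<partial>snd_law P) = (\<Sum>m | length m = n. H m * rect P [] m :: real)"
proof -
  have eq: "H (rev_prefix y n) = (\<Sum>m | length m = n. H m * indicator (cyl m) y)" for y
  proof -
    have "(\<Sum>m | length m = n. H m * indicator (cyl m) y) = (\<Sum>m | length m = n. if m = rev_prefix y n then H m else 0)"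
      by (intro sum.cong) (auto simp: mem_cyl_iff indicator_def)
    then show ?thesis by (simp add: sum.delta')
  qed
  have i: "integrable (snd_law P) (\<lambda>y. H m * indicator (cyl m) y)" for m
    by (intro integrable_mult_right integrable_real_indicator) (auto simp: N.emeasure_eq_measure)
  show "(\<integral>y. H (rev_prefix y n) \<partial>snd_law P) = (\<Sum>m | length m = n. H m * rect P [] m)"
    unfolding eq Bochner_Integration.integral_sum[OF i] by (simp add: rect_snd_law)
qed

text \<open>
  The martingale property: integrating against a function of the first \<open>n\<close> bits gives the same
  result at every later time \<open>n'\<close>.
\<close>

lemma integral_ratio_rev_prefix:
  assumes "n \<le> n'"
  shows "(\<integral>y. ratio P l n' y * F (rev_prefix y n) \<partial>snd_law P) = (\<Sum>m | length m = n. rect P l m * F m)"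
proof -
  have "(\<integral>y. ratio P l n' y * F (rev_prefix y n) \<partial>snd_law P) =
      (\<integral>y. (\<lambda>m. rect P l m / rect P [] m * F (drop (n' - n) m)) (rev_prefix y n') \<partial>snd_law P)"
    using assms by (simp add: ratio_def drop_rev_prefix)
  also have "\<dots> = (\<Sum>m | length m = n'. rect P l m / rect P [] m * F (drop (n' - n) m) * rect P [] m)"
    by (rule integral_rev_prefix)
  also have "\<dots> = (\<Sum>m | length m = n'. rect P l m * F (drop (n' - n) m))"
  proof (intro sum.cong refl)
    fix m
    show "rect P l m / rect P [] m * F (drop (n' - n) m) * rect P [] m = rect P l m * F (drop (n' - n) m)"
      (* division by zero is harmless, because the numerator vanishes as well *)
      using rect_nonneg[of l m] rect_le[of l m] by (cases "rect P [] m = 0") auto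
  qed
  also have "\<dots> = (\<Sum>m | length m = n. rect P l m * F m)"
    using assms
  proof (induction n' rule: dec_induct)
    case (step k)
    have "(\<Sum>m | length m = Suc k. rect P l m * F (drop (Suc k - n) m)) =
       (\<Sum>m | length m = k. rect P l (True # m) * F (drop (k - n) m) + rect P l (False # m) * F (drop (k - n) m))"
      using step(1) by (simp add: sum_lists_Suc Suc_diff_le)
    also have "\<dots> = (\<Sum>m | length m = k. rect P l m * F (drop (k - n) m))"
    proof (intro sum.cong refl)
      fix m
      show "rect P l (True # m) * F (drop (k - n) m) + rect P l (False # m) * F (drop (k - n) m) =
          rect P l m * F (drop (k - n) m)"
        unfolding rect_split2[of l m] by (rule distrib_right[symmetric])
    qed
    finally show ?case using step.IH by simp
  qed simp
  finally show ?thesis .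
qed

lemma integral_ratio_ratio:
  assumes "n \<le> n'"
  shows "(\<integral>y. ratio P l n' y * ratio P l n y \<partial>snd_law P) = energy P l n"
  using integral_ratio_rev_prefix[OF assms, of l "\<lambda>m. rect P l m / rect P [] m"]
  by (simp add: ratio_def energy_def)

lemma integrable_bounded_ratio:
  assumes "f \<in> borel_measurable cantor" "\<And>y. \<bar>f y\<bar> \<le> (1::real)"
  shows "integrable (snd_law P) f"
  using assms by (intro N.integrable_const_bound[where B = 1]) auto

text \<open>Orthogonality of martingale increments.\<close>

lemma integral_ratio_diff:
  assumes "n \<le> n'"
  shows "(\<integral>y. (ratio P l n' y - ratio P l n y)\<^sup>2 \<partial>snd_law P) = energy P l n' - energy P l n"
proof -
  have i: "integrable (snd_law P) (\<lambda>y. ratio P l k y * ratio P l k' y)" for k k'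
    using ratio_bounds by (intro integrable_bounded_ratio) (auto simp: abs_mult intro!: mult_le_one)
  have "(\<integral>y. (ratio P l n' y - ratio P l n y)\<^sup>2 \<partial>snd_law P) =
     (\<integral>y. ratio P l n' y * ratio P l n' y - 2 * (ratio P l n' y * ratio P l n y) + ratio P l n y * ratio P l n y \<partial>snd_law P)"
    by (simp add: power2_eq_square algebra_simps)
  also have "\<dots> = energy P l n' - 2 * energy P l n + energy P l n"
    using assms by (simp add: i integral_ratio_ratio)
  finally show ?thesis by simp
qed

lemma energy_mono: "n \<le> n' \<Longrightarrow> energy P l n \<le> energy P l n'"
  using integral_ratio_diff[of n n' l] Bochner_Integration.integral_nonneg[of "snd_law P" "\<lambda>y. (ratio P l n' y - ratio P l n y)\<^sup>2"]
  by simp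

lemma energy_le_1: "energy P l n \<le> 1"
proof -
  have "energy P l n = (\<integral>y. ratio P l n y * ratio P l n y \<partial>snd_law P)"
    by (rule integral_ratio_ratio[symmetric]) simp
  also have "\<dots> \<le> (\<integral>y. 1 \<partial>snd_law P)"
    using ratio_bounds
    by (intro integral_mono integrable_bounded_ratio) (auto simp: abs_mult intro!: mult_le_one)
  finally show ?thesis using N.prob_space by simp
qed

lemma energy_nonneg: "0 \<le> energy P l n"
  unfolding energy_def by (intro sum_nonneg mult_nonneg_nonneg divide_nonneg_nonneg rect_nonneg)

lemma level_ge: "j \<le> level P j"
    and level_energy: "\<And>i n'. i \<le> j \<Longrightarrow> level P j \<le> n' \<Longrightarrow>
      energy P (from_nat i) n' - energy P (from_nat i) (level P j) \<le> (1 / 4) ^ j"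
proof -
  let ?Q = "\<lambda>n. j \<le> n \<and> (\<forall>i\<le>j. \<forall>n'\<ge>n. energy P (from_nat i) n' - energy P (from_nat i) n \<le> (1 / 4) ^ j)"
  have "\<forall>\<^sub>F n in sequentially. \<forall>n'\<ge>n. energy P l n' - energy P l n \<le> (1 / 4) ^ j" for l
  proof -
    have "convergent (energy P l)"
      using energy_mono energy_le_1 energy_nonneg
      by (intro Bseq_mono_convergent BseqI'[where K = 1]) auto
    then obtain L where L: "energy P l \<longlonglongrightarrow> L" by (auto simp: convergent_def)
    have le: "energy P l n \<le> L" for n
      using energy_mono by (intro LIMSEQ_le_const[OF L]) auto
    have "\<forall>\<^sub>F n in sequentially. L - (1 / 4) ^ j < energy P l n"
      using L by (rule order_tendstoD) simp
    then show ?thesis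
      by eventually_elim (use le in \<open>smt (verit)\<close>)
  qed
  then have "\<forall>\<^sub>F n in sequentially. \<forall>i\<in>{..j}. \<forall>n'\<ge>n. energy P (from_nat i) n' - energy P (from_nat i) n \<le> (1 / 4) ^ j"
    by (intro eventually_ball_finite) auto
  then have "\<forall>\<^sub>F n in sequentially. ?Q n"
    using eventually_ge_at_top[of j] by eventually_elim auto
  then obtain n where "?Q n" by (metis (mono_tags, lifting) eventually_sequentially le_refl)
  then have "?Q (level P j)" unfolding level_def by (rule LeastI)
  then show "j \<le> level P j" "\<And>i n'. i \<le> j \<Longrightarrow> level P j \<le> n' \<Longrightarrow>
      energy P (from_nat i) n' - energy P (from_nat i) (level P j) \<le> (1 / 4) ^ j" by auto
qed

lemma level_Suc: "level P j \<le> level P (Suc j)"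
  unfolding level_def[of P j]
proof (rule Least_le, intro conjI allI impI)
  show "j \<le> level P (Suc j)" using level_ge[of "Suc j"] by simp
  fix i n' assume "i \<le> j" "level P (Suc j) \<le> n'"
  then have "energy P (from_nat i) n' - energy P (from_nat i) (level P (Suc j)) \<le> (1 / 4) ^ Suc j"
    by (intro level_energy) auto
  also have "\<dots> \<le> (1 / 4) ^ j" by simp
  finally show "energy P (from_nat i) n' - energy P (from_nat i) (level P (Suc j)) \<le> (1 / 4) ^ j" .
qed

text \<open>
  Squared distances of at most \<open>(1 / 4) ^ j\<close> give distances in \<open>L\<^sup>1\<close> of at most \<open>(1 / 2) ^ j\<close>, so the
  increments along the subsequence are almost everywhere absolutely summable.
\<close>

lemma AE_convergent_ratio:
  "AE y in snd_law P. convergent (\<lambda>j. ratio P l (level P j) y)"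
proof -
  obtain i where l: "l = from_nat i" by (metis from_nat_to_nat)
  \<comment> \<open>The list \<open>l\<close> is controlled from its position \<open>i\<close> in the enumeration onwards.\<close>
  define D where "D j y = ratio P l (level P (Suc (j + i))) y - ratio P l (level P (j + i)) y" for j y
  have [measurable]: "D j \<in> borel_measurable cantor" for j unfolding D_def by measurable
  have D1: "\<bar>D j y\<bar> \<le> 1" for j y
    using ratio_bounds[of l "level P (Suc (j + i))" y] ratio_bounds[of l "level P (j + i)" y]
    unfolding D_def by linarith
  have iD: "integrable (snd_law P) (\<lambda>y. \<bar>D j y\<bar>)" for j
    using D1 by (intro integrable_bounded_ratio) auto
  have iD2: "integrable (snd_law P) (\<lambda>y. (D j y)\<^sup>2)" for j
    using D1 by (intro integrable_bounded_ratio) (auto simp: abs_square_le_1)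
  have "(\<integral>y. \<bar>D j y\<bar> \<partial>snd_law P) \<le> (1 / 2) ^ j" for j
  proof -
    have "(\<integral>y. (D j y)\<^sup>2 \<partial>snd_law P) = energy P l (level P (Suc (j + i))) - energy P l (level P (j + i))"
      unfolding D_def by (intro integral_ratio_diff level_Suc)
    also have "\<dots> \<le> (1 / 4) ^ (j + i)"
      unfolding l by (intro level_energy level_Suc) auto
    also have "\<dots> \<le> (1 / 4) ^ j" by (simp add: power_add mult_le_one power_le_one)
    finally have D2: "(\<integral>y. (D j y)\<^sup>2 \<partial>snd_law P) \<le> (1 / 4) ^ j" .
    \<comment> \<open>The inequality of arithmetic and geometric means, with weights that balance both terms.\<close>
    have am: "\<bar>d\<bar> \<le> 2 ^ j / 2 * d\<^sup>2 + (1 / 2) ^ j / 2" for d :: real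
    proof -
      have "0 \<le> (2 ^ j * \<bar>d\<bar> - 1)\<^sup>2" by simp
      also have "\<dots> = 2 ^ j * (2 ^ j * d\<^sup>2 - 2 * \<bar>d\<bar>) + 1"
        by (simp add: power2_eq_square algebra_simps)
      finally have "0 \<le> (1 / 2) ^ j * (2 ^ j * (2 ^ j * d\<^sup>2 - 2 * \<bar>d\<bar>) + 1)" by simp
      also have "\<dots> = (2 ^ j * d\<^sup>2 - 2 * \<bar>d\<bar>) + (1 / 2) ^ j"
        by (simp add: distrib_left power_one_over)
      finally show ?thesis by (simp add: field_simps)
    qed
    have "(\<integral>y. \<bar>D j y\<bar> \<partial>snd_law P) \<le> (\<integral>y. 2 ^ j / 2 * (D j y)\<^sup>2 + (1 / 2) ^ j / 2 \<partial>snd_law P)"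
      using iD iD2 am by (intro integral_mono) auto
    also have "\<dots> = 2 ^ j / 2 * (\<integral>y. (D j y)\<^sup>2 \<partial>snd_law P) + (1 / 2) ^ j / 2"
      using iD2 N.prob_space by simp
    also have "\<dots> \<le> 2 ^ j / 2 * (1 / 4) ^ j + (1 / 2) ^ j / 2"
      using D2 by (intro add_mono mult_left_mono) auto
    also have "(2::real) ^ j / 2 * (1 / 4) ^ j = (1 / 2) ^ j / 2"
      by (simp add: power_mult_distrib[symmetric])
    finally show ?thesis by simp
  qed
  then have "(\<integral>\<^sup>+y. ennreal \<bar>D j y\<bar> \<partial>snd_law P) \<le> ennreal ((1 / 2) ^ j)" for j
    by (subst nn_integral_eq_integral) (auto simp: iD intro!: ennreal_leI)
  then have "(\<Sum>j. \<integral>\<^sup>+y. ennreal \<bar>D j y\<bar> \<partial>snd_law P) \<le> (\<Sum>j. ennreal ((1 / 2) ^ j))"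
    by (intro suminf_le) auto
  also have "\<dots> = ennreal (\<Sum>j. (1 / 2) ^ j)"
    by (intro suminf_ennreal2) (auto intro!: summable_geometric)
  finally have "(\<integral>\<^sup>+y. (\<Sum>j. ennreal \<bar>D j y\<bar>) \<partial>snd_law P) \<le> ennreal (\<Sum>j. (1 / 2) ^ j)"
    by (subst nn_integral_suminf) auto
  then have "(\<integral>\<^sup>+y. (\<Sum>j. ennreal \<bar>D j y\<bar>) \<partial>snd_law P) \<noteq> \<infinity>"
    by (auto simp: top_unique)
  then have "AE y in snd_law P. (\<Sum>j. ennreal \<bar>D j y\<bar>) \<noteq> \<infinity>"
    by (intro nn_integral_PInf_AE) auto
  then show ?thesis
  proof eventually_elim
    case (elim y)
    then have "summable (\<lambda>j. \<bar>D j y\<bar>)" by (intro summable_suminf_not_top) auto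
    then have "summable (\<lambda>j. D j y)" by (rule summable_rabs_cancel)
    then have "convergent (\<lambda>n. \<Sum>j<n. D j y)" by (simp add: summable_iff_convergent)
    moreover have "(\<Sum>j<n. D j y) = ratio P l (level P (n + i)) y - ratio P l (level P i) y" for n
      unfolding D_def using sum_lessThan_telescope[of "\<lambda>j. ratio P l (level P (j + i)) y" n] by simp
    ultimately have "convergent (\<lambda>n. ratio P l (level P (n + i)) y)"
      by (simp add: convergent_diff_const_right_iff)
    then show ?case unfolding convergent_def by (blast intro: LIMSEQ_offset)
  qed
qed

lemma AE_rect_pos: "AE y in snd_law P. \<forall>n. 0 < rect P [] (rev_prefix y n)"
proof -
  have "AE y in snd_law P. y \<in> cyl m \<longrightarrow> 0 < rect P [] m" for m
  proof (cases "rect P [] m = 0")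
    case True
    then have "AE y in snd_law P. y \<notin> cyl m"
      by (intro AE_not_in) (auto simp: null_sets_def rect_snd_law N.emeasure_eq_measure)
    then show ?thesis by eventually_elim simp
  next
    case False
    then show ?thesis using rect_nonneg[of "[]" m] by simp
  qed
  then have "AE y in snd_law P. \<forall>m. y \<in> cyl m \<longrightarrow> 0 < rect P [] m"
    by (simp add: AE_all_countable)
  then show ?thesis by eventually_elim simp
qed

lemma AE_ratio_tendsto:
  "AE y in snd_law P. \<forall>l. (\<lambda>j. ratio P l (level P j) y) \<longlonglongrightarrow> limit_weight P y l"
  using AE_convergent_ratio unfolding AE_all_countable limit_weight_def convergent_LIMSEQ_iff by simp

text \<open>
  Additivity in \<open>l\<close> holds for the ratios and passes to the limit. The total mass is one because
  almost surely no initial segment of \<open>y\<close> has probability zero.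
\<close>

lemma AE_cyl_weight: "AE y in snd_law P. cyl_weight (limit_weight P y)"
  using AE_ratio_tendsto AE_rect_pos
proof eventually_elim
  case (elim y)
  have lim: "(\<lambda>j. ratio P l (level P j) y) \<longlonglongrightarrow> limit_weight P y l" for l using elim by simp
  have "ratio P [] n y = 1" for n using elim by (simp add: ratio_def less_imp_neq[symmetric])
  then have "limit_weight P y [] = 1" using LIMSEQ_unique[OF lim[of "[]"]] by simp
  moreover have "0 \<le> limit_weight P y l" for l
    using lim[of l] by (rule LIMSEQ_le_const) (auto simp: ratio_bounds)
  moreover have "limit_weight P y l = limit_weight P y (True # l) + limit_weight P y (False # l)" for l
  proof (rule LIMSEQ_unique[OF lim])
    have "ratio P l n y = ratio P (True # l) n y + ratio P (False # l) n y" for n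
      unfolding ratio_def rect_split1[of l] by (simp add: add_divide_distrib)
    then show "(\<lambda>j. ratio P l (level P j) y) \<longlonglongrightarrow> limit_weight P y (True # l) + limit_weight P y (False # l)"
      using tendsto_add[OF lim[of "True # l"] lim[of "False # l"]] by simp
  qed
  ultimately show ?case unfolding cyl_weight_def by blast
qed

lemma measurable_limit_weight_snd [measurable]: "limit_weight P \<in> cantor \<rightarrow>\<^sub>M borel"
  using measurable_compose[OF measurable_Pair1'[OF in_prob_algebra, of cantor] measurable_limit_weight] by simp

lemma measurable_limit_weight_snd' [measurable]: "(\<lambda>y. limit_weight P y l) \<in> borel_measurable cantor"
  using measurable_compose[OF measurable_limit_weight_snd measurable_product_coordinates] .

text \<open>By dominated convergence: the integral of the ratio over \<open>cyl m\<close> is constant from time \<open>length m\<close> on.\<close>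

lemma integral_limit_weight:
  "integrable (snd_law P) (\<lambda>y. limit_weight P y l * indicator (cyl m) y)" (is ?i)
  "(\<integral>y. limit_weight P y l * indicator (cyl m) y \<partial>snd_law P) = rect P l m" (is ?e)
proof -
  let ?f = "\<lambda>j y. ratio P l (level P j) y * indicator (cyl m) y"
  have ae: "AE y in snd_law P. (\<lambda>j. ?f j y) \<longlonglongrightarrow> limit_weight P y l * indicator (cyl m) y"
    using AE_ratio_tendsto by eventually_elim (intro tendsto_mult_right, blast)
  have bd: "AE y in snd_law P. norm (?f j y) \<le> 1" for j
    using ratio_bounds by (auto simp: indicator_def)
  have c: "integrable (snd_law P) (\<lambda>_. 1::real)" by simp
  have l: "(\<lambda>j. \<integral>y. ?f j y \<partial>snd_law P) \<longlonglongrightarrow> (\<integral>y. limit_weight P y l * indicator (cyl m) y \<partial>snd_law P)"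
    by (rule integral_dominated_convergence[OF _ _ c ae bd]) measurable
  show ?i
    by (rule integrable_dominated_convergence[OF _ _ c ae bd]) measurable
  have "(\<integral>y. ?f j y \<partial>snd_law P) = rect P l m" if j: "length m \<le> j" for j
  proof -
    have "length m \<le> level P j" using j level_ge[of j] by simp
    then have "(\<integral>y. ratio P l (level P j) y * (\<lambda>m'. if m' = m then 1 else 0) (rev_prefix y (length m)) \<partial>snd_law P) =
       (\<Sum>m' | length m' = length m. rect P l m' * (if m' = m then 1 else 0))"
      by (rule integral_ratio_rev_prefix)
    also have "\<dots> = (\<Sum>m' | length m' = length m. if m' = m then rect P l m' else 0)"
      by (intro sum.cong) auto
    also have "\<dots> = rect P l m" by (simp add: sum.delta)
    finally show ?thesis by (simp add: cyl_def indicator_def of_bool_def)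
  qed
  then have "(\<lambda>j. \<integral>y. ?f j y \<partial>snd_law P) \<longlonglongrightarrow> rect P l m"
    by (intro tendsto_eventually) (auto simp: eventually_sequentially)
  then show ?e using l LIMSEQ_unique by blast
qed

end


section \<open>Measurable disintegration\<close>

lemma sets_cantor2: "sets cantor2 = sigma_sets UNIV (insert {} (range (\<lambda>(l, m). cyl l \<times> cyl m)))"
proof
  let ?G = "insert {} (range (\<lambda>(l, m). cyl l \<times> cyl m))"
  let ?N = "sigma UNIV ?G"
  have N: "sets ?N = sigma_sets UNIV ?G" "space ?N = UNIV" by simp_all
  have G: "cyl l \<times> cyl m \<in> ?G" for l m by (intro insertI2 image_eqI[of _ _ "(l, m)"]) auto
  have "fst \<in> ?N \<rightarrow>\<^sub>M cantor"
  proof (rule measurable_sigma_sets[OF sets_cantor_eq])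
    fix A assume "A \<in> insert {} (range cyl)"
    then show "fst -` A \<inter> space ?N \<in> sets ?N"
    proof (elim insertE rangeE)
      fix l assume A: "A = cyl l"
      have "fst -` A \<inter> space ?N = cyl l \<times> cyl []" by (auto simp: A)
      also have "\<dots> \<in> sets ?N" unfolding N(1) by (rule sigma_sets.Basic[OF G])
      finally show ?thesis .
    qed simp
  qed auto
  moreover have "snd \<in> ?N \<rightarrow>\<^sub>M cantor"
  proof (rule measurable_sigma_sets[OF sets_cantor_eq])
    fix A assume "A \<in> insert {} (range cyl)"
    then show "snd -` A \<inter> space ?N \<in> sets ?N"
    proof (elim insertE rangeE)
      fix l assume A: "A = cyl l"
      have "snd -` A \<inter> space ?N = cyl [] \<times> cyl l" by (auto simp: A)
      also have "\<dots> \<in> sets ?N" unfolding N(1) by (rule sigma_sets.Basic[OF G])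
      finally show ?thesis .
    qed simp
  qed auto
  ultimately have "(\<lambda>x. (fst x, snd x)) \<in> ?N \<rightarrow>\<^sub>M cantor2" by (rule measurable_Pair)
  then have m: "(\<lambda>x. x) \<in> ?N \<rightarrow>\<^sub>M cantor2" by simp
  show "sets cantor2 \<subseteq> sigma_sets UNIV ?G"
  proof
    fix A assume "A \<in> sets cantor2"
    from measurable_sets[OF m this] show "A \<in> sigma_sets UNIV ?G" by (simp add: N)
  qed
  have "?G \<subseteq> sets cantor2" using Times_cyl_sets by auto
  from sets.sigma_sets_subset[OF this] show "sigma_sets UNIV ?G \<subseteq> sets cantor2"
    by (simp add: space_pair_measure)
qed

lemma Int_stable_cyl2: "Int_stable (insert {} (range (\<lambda>(l, m). cyl l \<times> cyl m)))"
proof (rule Int_stableI)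
  fix A B assume A: "A \<in> insert {} (range (\<lambda>(l, m). cyl l \<times> cyl m))"
    and B: "B \<in> insert {} (range (\<lambda>(l, m). cyl l \<times> cyl m))"
  show "A \<inter> B \<in> insert {} (range (\<lambda>(l, m). cyl l \<times> cyl m))"
  proof (cases "A \<inter> B = {}")
    case False
    then obtain l m l' m' where AB: "A = cyl l \<times> cyl m" "B = cyl l' \<times> cyl m'" using A B by auto
    have *: "\<exists>k. cyl a \<inter> cyl b = cyl k" if "cyl a \<inter> cyl b \<noteq> {}" for a b
      using Int_stableD[OF Int_stable_cyl, of "cyl a" "cyl b"] that by auto
    have "A \<inter> B = (cyl l \<inter> cyl l') \<times> (cyl m \<inter> cyl m')" unfolding AB by auto
    moreover from this False have "cyl l \<inter> cyl l' \<noteq> {}" "cyl m \<inter> cyl m' \<noteq> {}" by auto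
    ultimately obtain a b where "A \<inter> B = cyl a \<times> cyl b" using * by metis
    then show ?thesis by auto
  qed simp
qed

lemma prob_cantor2_eqI:
  assumes "M \<in> space (prob_algebra cantor2)" "N \<in> space (prob_algebra cantor2)"
    and "\<And>l m. emeasure M (cyl l \<times> cyl m) = emeasure N (cyl l \<times> cyl m)"
  shows "M = N"
proof (rule measure_eqI_generator_eq[OF Int_stable_cyl2, where A = "\<lambda>_. UNIV"])
  interpret M: prob_space M using assms(1) by (simp add: space_prob_algebra)
  show "emeasure M X = emeasure N X" if "X \<in> insert {} (range (\<lambda>(l, m). cyl l \<times> cyl m))" for X
    using that assms(3) by auto
  show "sets M = sigma_sets UNIV (insert {} (range (\<lambda>(l, m). cyl l \<times> cyl m)))"
    "sets N = sigma_sets UNIV (insert {} (range (\<lambda>(l, m). cyl l \<times> cyl m)))"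
    using assms(1,2) by (simp_all add: space_prob_algebra sets_cantor2)
  have "cyl [] \<times> cyl [] \<in> range (\<lambda>(l, m). cyl l \<times> cyl m)"
    by (intro image_eqI[of _ _ "([], [])"]) auto
  then show "range (\<lambda>_::nat. UNIV) \<subseteq> insert {} (range (\<lambda>(l, m). cyl l \<times> cyl m))" by auto
  show "emeasure M UNIV \<noteq> \<infinity>" by simp
qed auto

lemma cyl_weight_nonneg: "cyl_weight w \<Longrightarrow> 0 \<le> w l"
  unfolding cyl_weight_def by blast

text \<open>
  One kernel disintegrates all laws at once: the law is part of its argument.
\<close>

definition cantor_cond ::
  "((nat \<Rightarrow> bool) \<times> (nat \<Rightarrow> bool)) measure \<times> (nat \<Rightarrow> bool) \<Rightarrow> (nat \<Rightarrow> bool) measure" where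
  "cantor_cond x = prob_of_weight (limit_weight (fst x) (snd x))"

lemma measurable_cantor_cond [measurable]:
  "cantor_cond \<in> prob_algebra cantor2 \<Otimes>\<^sub>M cantor \<rightarrow>\<^sub>M prob_algebra cantor"
  unfolding cantor_cond_def
  by (rule measurable_compose[OF measurable_limit_weight measurable_prob_of_weight])

lemma cantor_disintegration:
  assumes P: "P \<in> space (prob_algebra cantor2)"
  shows "P = snd_law P \<bind> (\<lambda>y. distr (cantor_cond (P, y)) cantor2 (\<lambda>x. (x, y)))"
proof (rule prob_cantor2_eqI[OF P])
  interpret P: cantor2_prob P
    using P by (simp add: space_prob_algebra cantor2_prob_def cantor2_prob_axioms_def)
  have m1: "(\<lambda>y. cantor_cond (P, y)) \<in> cantor \<rightarrow>\<^sub>M prob_algebra cantor"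
    using measurable_compose[OF measurable_Pair1'[OF P, of cantor] measurable_cantor_cond] .
  have m2: "(\<lambda>y. distr (cantor_cond (P, y)) cantor2 (\<lambda>x. (x, y))) \<in> cantor \<rightarrow>\<^sub>M prob_algebra cantor2"
    by (rule measurable_distr_prob_space2[OF m1]) measurable
  have "snd \<in> cantor2 \<rightarrow>\<^sub>M cantor" by measurable
  then have N: "snd_law P \<in> space (prob_algebra cantor)"
    using measurable_space[OF measurable_distr_prob_space P] by blast
  show "snd_law P \<bind> (\<lambda>y. distr (cantor_cond (P, y)) cantor2 (\<lambda>x. (x, y))) \<in> space (prob_algebra cantor2)"
    using prob_space_bind'[OF N m2] sets_bind'[OF N m2] by (simp add: space_prob_algebra)
  fix l m
  have em: "emeasure (distr (cantor_cond (P, y)) cantor2 (\<lambda>x. (x, y))) (cyl l \<times> cyl m) =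
      ennreal (limit_weight P y l * indicator (cyl m) y)" if w: "cyl_weight (limit_weight P y)" for y
  proof -
    have K: "cantor_cond (P, y) \<in> space (prob_algebra cantor)"
      using measurable_space[OF m1, of y] by simp
    then interpret K: prob_space "cantor_cond (P, y)" by (simp add: space_prob_algebra)
    have [measurable_cong, simp]: "sets (cantor_cond (P, y)) = sets cantor"
      using K by (simp add: space_prob_algebra)
    have "emeasure (distr (cantor_cond (P, y)) cantor2 (\<lambda>x. (x, y))) (cyl l \<times> cyl m) =
        emeasure (cantor_cond (P, y)) ((\<lambda>x. (x, y)) -` (cyl l \<times> cyl m) \<inter> space (cantor_cond (P, y)))"
      by (intro emeasure_distr) auto
    also have "(\<lambda>x. (x, y)) -` (cyl l \<times> cyl m) \<inter> space (cantor_cond (P, y)) = (if y \<in> cyl m then cyl l else {})"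
      using sets_eq_imp_space_eq[of "cantor_cond (P, y)" cantor] by auto
    also have "emeasure (cantor_cond (P, y)) \<dots> = ennreal (limit_weight P y l * indicator (cyl m) y)"
    proof -
      have "measure (cantor_cond (P, y)) (cyl l) = limit_weight P y l"
        by (simp add: cantor_cond_def measure_prob_of_weight[OF w])
      then show ?thesis by (simp add: K.emeasure_eq_measure indicator_def)
    qed
    finally show ?thesis .
  qed
  have "emeasure (snd_law P \<bind> (\<lambda>y. distr (cantor_cond (P, y)) cantor2 (\<lambda>x. (x, y)))) (cyl l \<times> cyl m) =
      (\<integral>\<^sup>+y. emeasure (distr (cantor_cond (P, y)) cantor2 (\<lambda>x. (x, y))) (cyl l \<times> cyl m) \<partial>snd_law P)"
    by (rule emeasure_bind_prob_algebra[OF N m2]) simp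
  also have "\<dots> = (\<integral>\<^sup>+y. ennreal (limit_weight P y l * indicator (cyl m) y) \<partial>snd_law P)"
    using P.AE_cyl_weight by (intro nn_integral_cong_AE) (auto simp: em)
  also have "\<dots> = ennreal (\<integral>y. limit_weight P y l * indicator (cyl m) y \<partial>snd_law P)"
  proof (rule nn_integral_eq_integral[OF P.integral_limit_weight(1)])
    show "AE y in snd_law P. 0 \<le> limit_weight P y l * indicator (cyl m) y"
      using P.AE_cyl_weight by eventually_elim (simp add: cyl_weight_nonneg)
  qed
  also have "\<dots> = emeasure P (cyl l \<times> cyl m)"
    by (simp add: P.integral_limit_weight(2) rect_def P.emeasure_eq_measure)
  finally show "emeasure P (cyl l \<times> cyl m) =
      emeasure (snd_law P \<bind> (\<lambda>y. distr (cantor_cond (P, y)) cantor2 (\<lambda>x. (x, y)))) (cyl l \<times> cyl m)" ..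
qed

lemma measurable_eq_cantor:
  assumes "f \<in> M \<rightarrow>\<^sub>M cantor" "g \<in> M \<rightarrow>\<^sub>M cantor"
  shows "Measurable.pred M (\<lambda>x. f x = g x)"
proof -
  have "Measurable.pred M (\<lambda>x. f x n)" "Measurable.pred M (\<lambda>x. g x n)" for n
    using assms by (auto intro: measurable_bit_of)
  then have "Measurable.pred M (\<lambda>x. \<forall>n. f x n = g x n)"
    by (intro pred_intros_countable pred_intros_logic)
  then show ?thesis by (simp add: fun_eq_iff)
qed

text \<open>
  Embed \<open>C\<close> and \<open>D\<close> into the Cantor space by \<open>e\<close> and \<open>i\<close>, disintegrate the joint law of \<open>e x\<close>
  and \<open>i (h x)\<close>, and bring the conditional laws back to \<open>C\<close> with the retraction \<open>r\<close>. That the fibre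
  is the right one is an almost sure property of the joint law, which is passed to the conditional laws.
\<close>

theorem disintegration:
  assumes C: "standard_borel C" and D: "standard_borel D" and h[measurable]: "h \<in> C \<rightarrow>\<^sub>M D"
  obtains k where "k \<in> prob_algebra C \<Otimes>\<^sub>M D \<rightarrow>\<^sub>M prob_algebra C"
    "\<forall>p\<in>space (prob_algebra C). distr p D h \<bind> (\<lambda>y. k (p, y)) = p"
    "\<forall>p\<in>space (prob_algebra C). AE y in distr p D h. AE x in k (p, y). h x = y"
proof (cases "space C = {}")
  case True
  then have "space (prob_algebra C) = {}" by (rule space_prob_algebra_empty)
  then show ?thesis
    using that[of "\<lambda>_. undefined"] by (simp add: measurable_empty_iff space_pair_measure)
next
  case False
  then have "space D \<noteq> {}" using measurable_space[OF h] by auto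
  obtain e r where e[measurable]: "e \<in> C \<rightarrow>\<^sub>M cantor" and r[measurable]: "r \<in> cantor \<rightarrow>\<^sub>M C"
    and re: "\<forall>x\<in>space C. r (e x) = x"
    using meas_retract_cantor_if_standard_borel[OF C False] by (rule meas_retractE)
  obtain i q where i[measurable]: "i \<in> D \<rightarrow>\<^sub>M cantor" and "q \<in> cantor \<rightarrow>\<^sub>M D"
    and qi: "\<forall>x\<in>space D. q (i x) = x"
    using meas_retract_cantor_if_standard_borel[OF D \<open>space D \<noteq> {}\<close>] by (rule meas_retractE)
  define J where "J p = distr p cantor2 (\<lambda>x. (e x, i (h x)))" for p
  have J: "J \<in> prob_algebra C \<rightarrow>\<^sub>M prob_algebra cantor2"
    unfolding J_def by (intro measurable_distr_prob_space) measurable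
  define k where "k x = distr (cantor_cond (J (fst x), i (snd x))) C r" for x
  have "(\<lambda>x. (J (fst x), i (snd x))) \<in> prob_algebra C \<Otimes>\<^sub>M D \<rightarrow>\<^sub>M prob_algebra cantor2 \<Otimes>\<^sub>M cantor"
    using J by measurable
  then have "(\<lambda>x. cantor_cond (J (fst x), i (snd x))) \<in> prob_algebra C \<Otimes>\<^sub>M D \<rightarrow>\<^sub>M prob_algebra cantor"
    by (rule measurable_compose[OF _ measurable_cantor_cond])
  then have k: "k \<in> prob_algebra C \<Otimes>\<^sub>M D \<rightarrow>\<^sub>M prob_algebra C"
    unfolding k_def by (rule measurable_compose[OF _ measurable_distr_prob_space[OF r]])
  have "distr p D h \<bind> (\<lambda>y. k (p, y)) = p \<and> (AE y in distr p D h. AE x in k (p, y). h x = y)"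
    if p: "p \<in> space (prob_algebra C)" for p
  proof
    interpret p: prob_space p using p by (simp add: space_prob_algebra)
    have [measurable_cong, simp]: "sets p = sets C" using p by (simp add: space_prob_algebra)
    have sp[simp]: "space p = space C" by (rule sets_eq_imp_space_eq) simp
    have Jp: "J p \<in> space (prob_algebra cantor2)" using measurable_space[OF J p] .
    define c where "c z = cantor_cond (J p, z)" for z
    have c: "c \<in> cantor \<rightarrow>\<^sub>M prob_algebra cantor"
      unfolding c_def
      using measurable_compose[OF measurable_Pair1'[OF Jp, of cantor] measurable_cantor_cond] .
    have c_sub: "c \<in> cantor \<rightarrow>\<^sub>M subprob_algebra cantor" using c by (rule measurable_prob_algebraD)
    have c_sets[measurable_cong, simp]: "sets (c z) = sets cantor" for z
      using measurable_space[OF c, of z] by (simp add: space_prob_algebra)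
    have nu: "snd_law (J p) = distr (distr p D h) cantor i"
      unfolding J_def by (simp add: distr_distr comp_def)
    define c2 where "c2 z = distr (c z) cantor2 (\<lambda>x. (x, z))" for z
    have c2: "c2 \<in> cantor \<rightarrow>\<^sub>M prob_algebra cantor2"
      unfolding c2_def by (rule measurable_distr_prob_space2[OF c]) measurable
    have c2_sub: "c2 \<in> snd_law (J p) \<rightarrow>\<^sub>M subprob_algebra cantor2"
      using measurable_prob_algebraD[OF c2] by simp
    have dis: "J p = snd_law (J p) \<bind> c2"
      unfolding c2_def c_def by (rule cantor_disintegration[OF Jp])
    have m: "(\<lambda>w. r (fst w)) \<in> cantor2 \<rightarrow>\<^sub>M C" by measurable
    have "distr (J p) C (\<lambda>w. r (fst w)) = distr p C (\<lambda>x. r (e x))"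
      unfolding J_def by (simp add: distr_distr comp_def)
    also have "\<dots> = distr p C (\<lambda>x. x)" using re by (intro distr_cong) auto
    also have "\<dots> = p" by (rule distr_id2) simp
    finally have "p = distr (snd_law (J p) \<bind> c2) C (\<lambda>w. r (fst w))" using dis by simp
    also have "\<dots> = snd_law (J p) \<bind> (\<lambda>z. distr (c2 z) C (\<lambda>w. r (fst w)))"
      by (rule distr_bind[OF c2_sub _ m]) simp
    also have "\<dots> = snd_law (J p) \<bind> (\<lambda>z. distr (c z) C r)"
      unfolding c2_def by (simp add: distr_distr comp_def)
    also have "\<dots> = distr p D h \<bind> (\<lambda>y. distr (c (i y)) C r)"
      unfolding nu
      by (rule bind_distr[where K = C])
         (use measurable_compose[OF c_sub measurable_distr[OF r]] p.not_empty \<open>space D \<noteq> {}\<close> in auto)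
    finally show "distr p D h \<bind> (\<lambda>y. k (p, y)) = p" unfolding k_def c_def by simp
    have pr: "Measurable.pred cantor2 (\<lambda>w. i (h (r (fst w))) = snd w)"
      by (rule measurable_eq_cantor) measurable
    have "AE w in J p. i (h (r (fst w))) = snd w"
      unfolding J_def
      by (subst AE_distr_iff) (use pr re in \<open>auto simp: pred_def\<close>)
    then have "AE w in snd_law (J p) \<bind> c2. i (h (r (fst w))) = snd w"
      by (subst dis[symmetric])
    then have "AE z in snd_law (J p). AE w in c2 z. i (h (r (fst w))) = snd w"
      unfolding AE_bind[OF c2_sub pr] .
    then have "AE z in snd_law (J p). AE x in c z. i (h (r x)) = z"
    proof eventually_elim
      case (elim z)
      then show ?case unfolding c2_def using pr by (subst (asm) AE_distr_iff) (auto simp: pred_def)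
    qed
    then have "AE y in distr p D h. AE x in c (i y). i (h (r x)) = i y"
      unfolding nu by (rule AE_distrD[rotated]) simp
    moreover have "AE y in distr p D h. y \<in> space D" by (rule AE_I2) simp
    ultimately show "AE y in distr p D h. AE x in k (p, y). h x = y"
    proof eventually_elim
      case (elim y)
      have "{x \<in> space C. i (h x) = i y} \<in> sets C"
        using measurable_eq_cantor[of "\<lambda>x. i (h x)" C "\<lambda>_. i y"] by (simp add: pred_def)
      then have "AE x in k (p, y). i (h x) = i y"
        using elim unfolding k_def c_def[symmetric] fst_conv snd_conv by (subst AE_distr_iff) simp_all
      moreover have "AE x in k (p, y). x \<in> space C" unfolding k_def by (rule AE_I2) simp
      ultimately show ?case
      proof eventually_elim
        case (elim x)
        then show ?case using qi measurable_space[OF h] \<open>y \<in> space D\<close> by metis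
      qed
    qed
  qed
  then show ?thesis using that[OF k] by blast
qed


section \<open>Sections of weak pullbacks\<close>

lemma meas_retract_cantor2: "meas_retract cantor2 cantor"
  unfolding meas_retract_def
proof (intro exI conjI ballI)
  let ?i = "\<lambda>x n. if even n then fst x (n div 2) else snd x (n div 2)"
  let ?r = "\<lambda>c. (\<lambda>n. c (2 * n), \<lambda>n. c (Suc (2 * n)))"
  show "?i \<in> cantor2 \<rightarrow>\<^sub>M cantor"
  proof (rule measurable_to_cantor)
    fix n
    have "Measurable.pred cantor2 (\<lambda>x. fst x (n div 2))" "Measurable.pred cantor2 (\<lambda>x. snd x (n div 2))"
      by (auto intro: measurable_bit_of)
    then show "Measurable.pred cantor2 (\<lambda>x. ?i x n)" by (cases "even n") auto
  qed
  show "?r \<in> cantor \<rightarrow>\<^sub>M cantor2"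
    by (intro measurable_Pair measurable_to_cantor measurable_bit)
  show "?r (?i x) = x" for x :: "(nat \<Rightarrow> bool) \<times> (nat \<Rightarrow> bool)" by simp
qed

text \<open>
  Weak pullbacks are tested on spaces of reals. Since standard Borel spaces are defined without
  reference to an ambient topology, any injection of the Cantor space into the reals, regardless of
  measurability, carries over its structure.
\<close>

lemma ex_real_copy_of_cantor:
  obtains R :: "real measure" and i j where "standard_borel R"
    "i \<in> cantor \<rightarrow>\<^sub>M R" "j \<in> R \<rightarrow>\<^sub>M cantor" "\<forall>a. j (i a) = a"
proof -
  obtain b :: "nat set \<Rightarrow> real" where b: "bij b"
    using nat_sets_eqpoll_reals unfolding eqpoll_def by auto
  define i where "i a = b {n. a n}" for a
  define j where "j x n \<longleftrightarrow> n \<in> inv b x" for x n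
  have ji: "j (i a) = a" for a
    unfolding i_def j_def using b by (simp add: bij_is_inj)
  define R where "R = vimage_algebra (range i) j cantor"
  have j: "j \<in> R \<rightarrow>\<^sub>M cantor"
    unfolding R_def by (rule measurable_vimage_algebra1) auto
  have i: "i \<in> cantor \<rightarrow>\<^sub>M R"
    unfolding R_def by (rule measurable_vimage_algebra2) (auto simp: ji)
  have "meas_retract R cantor"
    unfolding meas_retract_def using i j ji by (intro exI[of _ j] exI[of _ i]) (auto simp: R_def)
  then have "standard_borel R" by (rule standard_borel_if_meas_retract_cantor)
  then show ?thesis using that i j ji by blast
qed

lemma measurable_eq_standard_borel:
  assumes "standard_borel D" and f: "f \<in> M \<rightarrow>\<^sub>M D" and g: "g \<in> M \<rightarrow>\<^sub>M D"
  shows "Measurable.pred M (\<lambda>x. f x = g x)"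
proof (cases "space D = {}")
  case True
  then have "space M = {}" using measurable_space[OF f] by auto
  then show ?thesis by (simp add: measurable_def)
next
  case False
  obtain i r where i: "i \<in> D \<rightarrow>\<^sub>M cantor" and "r \<in> cantor \<rightarrow>\<^sub>M D" and ri: "\<forall>x\<in>space D. r (i x) = x"
    using meas_retract_cantor_if_standard_borel[OF assms(1) False] by (rule meas_retractE)
  have P: "Measurable.pred M (\<lambda>x. i (f x) = i (g x))"
    using f g i by (intro measurable_eq_cantor measurable_compose[OF _ i])
  have "i (f x) = i (g x) \<longleftrightarrow> f x = g x" if "x \<in> space M" for x
    using measurable_space[OF f that] measurable_space[OF g that] ri by metis
  from iffD1[OF measurable_cong[OF this] P] show ?thesis .
qed

text \<open>
  The universal test object is the set \<open>E\<close> of compatible pairs. It is a retract of the Cantor space,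
  so testing with a copy of the latter yields a lift of \<open>E\<close> to \<open>A\<close>, which is then extended to all
  pairs with the value at \<open>(b0, c0)\<close>.
\<close>

lemma weak_pullback_section:
  assumes wp: "weak_pullback TYPE(real) A B C D f g m n"
    and ne: "b0 \<in> space B" "c0 \<in> space C" "m b0 = n c0"
  obtains t where "t \<in> B \<Otimes>\<^sub>M C \<rightarrow>\<^sub>M A"
    "\<forall>b\<in>space B. \<forall>c\<in>space C. m b = n c \<longrightarrow> f (t (b, c)) = b \<and> g (t (b, c)) = c"
proof -
  have sb: "standard_borel A" "standard_borel B" "standard_borel C" "standard_borel D"
    and m[measurable]: "m \<in> B \<rightarrow>\<^sub>M D" and n[measurable]: "n \<in> C \<rightarrow>\<^sub>M D"
    using wp by (auto simp: weak_pullback_def sb_hom_def)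
  define E where "E = {x \<in> space (B \<Otimes>\<^sub>M C). m (fst x) = n (snd x)}"
  have E: "E \<in> sets (B \<Otimes>\<^sub>M C)"
    using measurable_eq_standard_borel[OF sb(4), of "\<lambda>x. m (fst x)" "B \<Otimes>\<^sub>M C" "\<lambda>x. n (snd x)"]
    unfolding E_def pred_def by simp
  have E0: "(b0, c0) \<in> E" using ne by (simp add: E_def space_pair_measure)
  let ?Z = "restrict_space (B \<Otimes>\<^sub>M C) E"
  have spZ: "space ?Z = E" using sets.sets_into_space[OF E] by (auto simp: space_restrict_space)
  have "meas_retract (B \<Otimes>\<^sub>M C) cantor2"
    using ne sb by (intro meas_retract_pair meas_retract_cantor_if_standard_borel) auto
  then have "meas_retract ?Z cantor"
    using meas_retract_restrict_space[OF E] E0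
    by (intro meas_retract_trans[OF _ meas_retract_trans[OF _ meas_retract_cantor2]]) auto
  then obtain e r where e: "e \<in> ?Z \<rightarrow>\<^sub>M cantor" and r: "r \<in> cantor \<rightarrow>\<^sub>M ?Z"
    and re: "\<forall>x\<in>space ?Z. r (e x) = x"
    by (rule meas_retractE)
  obtain R :: "real measure" and i j where R: "standard_borel R" and i: "i \<in> cantor \<rightarrow>\<^sub>M R"
    and j: "j \<in> R \<rightarrow>\<^sub>M cantor" and ji: "\<forall>a. j (i a) = a"
    by (rule ex_real_copy_of_cantor)
  have rj: "(\<lambda>x. r (j x)) \<in> R \<rightarrow>\<^sub>M ?Z" using measurable_compose[OF j r] .
  then have rj': "(\<lambda>x. r (j x)) \<in> R \<rightarrow>\<^sub>M B \<Otimes>\<^sub>M C" by (simp add: measurable_restrict_space2_iff)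
  have q: "(\<lambda>x. fst (r (j x))) \<in> sb_hom R B"
    using measurable_compose[OF rj' measurable_fst] R sb by (simp add: sb_hom_def)
  have p: "(\<lambda>x. snd (r (j x))) \<in> sb_hom R C"
    using measurable_compose[OF rj' measurable_snd] R sb by (simp add: sb_hom_def)
  have eq: "\<forall>x\<in>space R. m (fst (r (j x))) = n (snd (r (j x)))"
    using measurable_space[OF rj] unfolding spZ by (auto simp: E_def)
  have "\<forall>S :: real measure. \<forall>q\<in>sb_hom S B. \<forall>p\<in>sb_hom S C. (\<forall>s\<in>space S. m (q s) = n (p s)) \<longrightarrow>
      (\<exists>r\<in>sb_hom S A. \<forall>s\<in>space S. f (r s) = q s \<and> g (r s) = p s)"
    using wp unfolding weak_pullback_def by (elim conjE)
  from this[THEN spec, THEN bspec, OF q, THEN bspec, OF p, THEN mp, OF eq]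
  obtain u where u: "u \<in> sb_hom R A"
    and fu: "\<forall>x\<in>space R. f (u x) = fst (r (j x)) \<and> g (u x) = snd (r (j x))"
    by blast
  define \<rho> where "\<rho> x = (if x \<in> E then x else (b0, c0))" for x
  have \<rho>: "\<rho> \<in> B \<Otimes>\<^sub>M C \<rightarrow>\<^sub>M ?Z"
    unfolding \<rho>_def using E E0 sets.sets_into_space[OF E]
    by (intro measurable_restrict_space2) (auto intro!: measurable_If_set)
  define t where "t x = u (i (e (\<rho> x)))" for x
  have "t \<in> B \<Otimes>\<^sub>M C \<rightarrow>\<^sub>M A"
    unfolding t_def using u
    by (intro measurable_compose[OF measurable_compose[OF measurable_compose[OF \<rho> e] i]]) (simp add: sb_hom_def)
  moreover have "f (t (b, c)) = b \<and> g (t (b, c)) = c" if "b \<in> space B" "c \<in> space C" "m b = n c" for b c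
  proof -
    have bc: "(b, c) \<in> E" using that by (simp add: E_def space_pair_measure)
    then have "e (b, c) \<in> space cantor" by simp
    then have "i (e (b, c)) \<in> space R" by (rule measurable_space[OF i])
    moreover have "r (e (b, c)) = (b, c)" using re bc spZ by blast
    ultimately show ?thesis using fu ji bc by (simp add: t_def \<rho>_def)
  qed
  ultimately show ?thesis using that by blast
qed

section \<open>Preservation of weak pullbacks\<close>

lemma giry_map_sb_hom:
  assumes "f \<in> sb_hom X Y"
  shows "giry_map Y f \<in> sb_hom (prob_algebra X) (prob_algebra Y)"
  using assms by (auto simp: sb_hom_def standard_borel_prob_algebra intro: measurable_distr_prob_space)

text \<open>
  The mediating map is \<open>r\<close> below: \<open>\<kappa> s b\<close> is the law of \<open>t (b, c)\<close> for \<open>c\<close> drawn from the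
  disintegration of \<open>p s\<close> over \<open>m b\<close>, and \<open>b\<close> is drawn from \<open>q s\<close>.
\<close>

lemma weak_pullback_prob_algebra:
  assumes wp: "weak_pullback TYPE(real) A B C D f g m n"
  shows "weak_pullback TYPE('s) (prob_algebra A) (prob_algebra B) (prob_algebra C) (prob_algebra D)
    (giry_map B f) (giry_map C g) (giry_map D m) (giry_map D n)"
proof -
  have hom: "f \<in> sb_hom A B" "g \<in> sb_hom A C" "m \<in> sb_hom B D" "n \<in> sb_hom C D"
    and comm: "\<forall>x\<in>space A. m (f x) = n (g x)"
    using wp by (auto simp: weak_pullback_def)
  have sb: "standard_borel A" "standard_borel B" "standard_borel C" "standard_borel D"
    and f[measurable]: "f \<in> A \<rightarrow>\<^sub>M B" and g[measurable]: "g \<in> A \<rightarrow>\<^sub>M C"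
    and m[measurable]: "m \<in> B \<rightarrow>\<^sub>M D" and n[measurable]: "n \<in> C \<rightarrow>\<^sub>M D"
    using hom by (auto simp: sb_hom_def)
  have comm': "distr (distr x B f) D m = distr (distr x C g) D n" if "x \<in> space (prob_algebra A)" for x
  proof -
    have s[measurable_cong]: "sets x = sets A" using that by (simp add: space_prob_algebra)
    have "distr x D (\<lambda>a. m (f a)) = distr x D (\<lambda>a. n (g a))"
      using comm sets_eq_imp_space_eq[OF s] by (intro distr_cong) auto
    then show ?thesis by (simp add: distr_distr comp_def)
  qed
  obtain l where l: "l \<in> prob_algebra C \<Otimes>\<^sub>M D \<rightarrow>\<^sub>M prob_algebra C"
    and l1: "\<forall>p\<in>space (prob_algebra C). distr p D n \<bind> (\<lambda>y. l (p, y)) = p"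
    and l2: "\<forall>p\<in>space (prob_algebra C). AE y in distr p D n. AE c in l (p, y). n c = y"
    using disintegration[OF sb(3,4) n] .
  have "\<exists>r\<in>sb_hom S (prob_algebra A). \<forall>s\<in>space S. distr (r s) B f = q s \<and> distr (r s) C g = p s"
    if q: "q \<in> sb_hom S (prob_algebra B)" and p: "p \<in> sb_hom S (prob_algebra C)"
      and eq: "\<forall>s\<in>space S. distr (q s) D m = distr (p s) D n" for S :: "'s measure" and q p
  proof -
    have S: "standard_borel S" and qm[measurable]: "q \<in> S \<rightarrow>\<^sub>M prob_algebra B"
      and pm[measurable]: "p \<in> S \<rightarrow>\<^sub>M prob_algebra C"
      using q p by (auto simp: sb_hom_def)
    have fibre: "AE b in q s. AE c in l (p s, m b). n c = m b" if s: "s \<in> space S" for s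
    proof -
      have mq: "m \<in> q s \<rightarrow>\<^sub>M D"
        using measurable_space[OF qm s] m by (simp add: space_prob_algebra cong: measurable_cong_sets)
      have "AE y in distr (q s) D m. AE c in l (p s, y). n c = y"
        unfolding eq[rule_format, OF s] using l2 measurable_space[OF pm s] by (rule bspec)
      then show ?thesis by (rule AE_distrD[OF mq])
    qed
    have ls: "l (p s, m b) \<in> space (prob_algebra C)" if "s \<in> space S" "b \<in> space B" for s b
      using that measurable_space[OF pm] measurable_space[OF m]
      by (intro measurable_space[OF l]) (auto simp: space_pair_measure)
    show ?thesis
    (* without compatible pairs there is no section t, but then no test point either *)
    proof (cases "\<exists>b\<in>space B. \<exists>c\<in>space C. m b = n c")
      case False
      have "s \<notin> space S" for s
      proof
        assume s: "s \<in> space S"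
        then have qs: "prob_space (q s)" "sets (q s) = sets B"
          using measurable_space[OF qm] by (auto simp: space_prob_algebra)
        have "AE b in q s. b \<in> space B" using sets_eq_imp_space_eq[OF qs(2)] by (intro AE_I2) simp
        with fibre[OF s] have "AE b in q s. False"
        proof eventually_elim
          case (elim b)
          have "prob_space (l (p s, m b))" "sets (l (p s, m b)) = sets C"
            using ls[OF s elim(2)] by (auto simp: space_prob_algebra)
          moreover from this have "AE c in l (p s, m b). c \<in> space C"
            using sets_eq_imp_space_eq by (intro AE_I2) blast
          with elim(1) have "AE c in l (p s, m b). False"
            by eventually_elim (use False elim(2) in metis)
          ultimately show False by (simp add: prob_space.AE_const)
        qed
        then show False using qs(1) by (simp add: prob_space.AE_const)
      qed
      then have "space S = {}" by auto
      then have "(\<lambda>_. undefined) \<in> S \<rightarrow>\<^sub>M prob_algebra A" by (simp add: measurable_def)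
      then show ?thesis
        using S sb \<open>space S = {}\<close> by (auto simp: sb_hom_def standard_borel_prob_algebra)
    next
      case True
      then obtain t where t[measurable]: "t \<in> B \<Otimes>\<^sub>M C \<rightarrow>\<^sub>M A"
        and ft: "\<forall>b\<in>space B. \<forall>c\<in>space C. m b = n c \<longrightarrow> f (t (b, c)) = b \<and> g (t (b, c)) = c"
        using weak_pullback_section[OF wp] by metis
      define \<kappa> where "\<kappa> s b = distr (l (p s, m b)) A (\<lambda>c. t (b, c))" for s b
      define r where "r s = q s \<bind> \<kappa> s" for s
      have "(\<lambda>x. (p (fst x), m (snd x))) \<in> S \<Otimes>\<^sub>M B \<rightarrow>\<^sub>M prob_algebra C \<Otimes>\<^sub>M D" by measurable
      then have lm: "(\<lambda>x. l (p (fst x), m (snd x))) \<in> S \<Otimes>\<^sub>M B \<rightarrow>\<^sub>M prob_algebra C"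
        by (rule measurable_compose[OF _ l])
      have \<kappa>: "(\<lambda>(s, b). \<kappa> s b) \<in> S \<Otimes>\<^sub>M B \<rightarrow>\<^sub>M prob_algebra A"
        unfolding \<kappa>_def split_beta' by (rule measurable_distr_prob_space2[OF lm]) measurable
      have rm: "r \<in> S \<rightarrow>\<^sub>M prob_algebra A"
        unfolding r_def by (rule measurable_bind_prob_space2[OF qm \<kappa>])
      have "distr (r s) B f = q s \<and> distr (r s) C g = p s" if s: "s \<in> space S" for s
      proof
        have qs: "q s \<in> space (prob_algebra B)" and ps: "p s \<in> space (prob_algebra C)"
          using s measurable_space[OF qm] measurable_space[OF pm] by auto
        interpret q: prob_space "q s" using qs by (simp add: space_prob_algebra)
        have sq[measurable_cong, simp]: "sets (q s) = sets B" using qs by (simp add: space_prob_algebra)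
        have spq: "space (q s) = space B" by (rule sets_eq_imp_space_eq) simp
        have \<kappa>s: "\<kappa> s \<in> B \<rightarrow>\<^sub>M prob_algebra A"
          using measurable_compose[OF measurable_Pair1'[OF s, of B] \<kappa>] by simp
        have \<kappa>sub: "\<kappa> s \<in> q s \<rightarrow>\<^sub>M subprob_algebra A"
          using measurable_prob_algebraD[OF \<kappa>s] by (simp cong: measurable_cong_sets)
        have lb: "(\<lambda>b. l (p s, m b)) \<in> B \<rightarrow>\<^sub>M prob_algebra C"
          using measurable_compose[OF measurable_Pair1'[OF s, of B] lm] by simp
        have AEB: "AE b in q s. b \<in> space B" using spq by (intro AE_I2) simp
        have AEt: "AE b in q s. AE c in l (p s, m b). f (t (b, c)) = b \<and> g (t (b, c)) = c"
          using fibre[OF s] AEB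
        proof eventually_elim
          case (elim b)
          have "AE c in l (p s, m b). c \<in> space C"
            using ls[OF s elim(2)] sets_eq_imp_space_eq[of "l (p s, m b)" C]
            by (intro AE_I2) (auto simp: space_prob_algebra)
          with elim(1) show ?case by eventually_elim (use ft elim(2) in metis)
        qed
        have tm: "(\<lambda>c. t (b, c)) \<in> l (p s, m b) \<rightarrow>\<^sub>M A" if b: "b \<in> space B" for b
        proof -
          have "(\<lambda>c. t (b, c)) \<in> C \<rightarrow>\<^sub>M A" using b by measurable
          then show ?thesis
            using ls[OF s b] by (simp add: space_prob_algebra cong: measurable_cong_sets)
        qed
        have K: "distr (\<kappa> s b) M u = distr (l (p s, m b)) M (\<lambda>c. u (t (b, c)))"
          if b: "b \<in> space B" and u: "u \<in> A \<rightarrow>\<^sub>M M" for b u and M :: "'z measure"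
          unfolding \<kappa>_def using distr_distr[OF u tm[OF b]] by (simp add: comp_def)
        have "distr (r s) B f = q s \<bind> (\<lambda>b. distr (\<kappa> s b) B f)"
          unfolding r_def by (rule distr_bind[OF \<kappa>sub q.not_empty f])
        also have "\<dots> = q s \<bind> return B"
        proof (rule bind_cong_AE'[OF qs])
          show "(\<lambda>b. distr (\<kappa> s b) B f) \<in> B \<rightarrow>\<^sub>M prob_algebra B"
            by (rule measurable_compose[OF \<kappa>s measurable_distr_prob_space[OF f]])
          show "AE b in q s. distr (\<kappa> s b) B f = return B b"
            using AEt AEB
          proof eventually_elim
            case (elim b)
            interpret l: prob_space "l (p s, m b)" using ls[OF s elim(2)] by (simp add: space_prob_algebra)
            have "distr (\<kappa> s b) B f = distr (l (p s, m b)) B (\<lambda>_. b)"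
              unfolding K[OF elim(2) f]
              using elim measurable_compose[OF tm f] by (intro distr_cong_AE) auto
            then show ?case using elim(2) by simp
          qed
        qed simp
        also have "\<dots> = q s" by (rule bind_return'') simp
        finally show "distr (r s) B f = q s" .
        have "distr (r s) C g = q s \<bind> (\<lambda>b. distr (\<kappa> s b) C g)"
          unfolding r_def by (rule distr_bind[OF \<kappa>sub q.not_empty g])
        also have "\<dots> = q s \<bind> (\<lambda>b. l (p s, m b))"
        proof (rule bind_cong_AE'[OF qs _ lb])
          show "(\<lambda>b. distr (\<kappa> s b) C g) \<in> B \<rightarrow>\<^sub>M prob_algebra C"
            by (rule measurable_compose[OF \<kappa>s measurable_distr_prob_space[OF g]])
          show "AE b in q s. distr (\<kappa> s b) C g = l (p s, m b)"
            using AEt AEB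
          proof eventually_elim
            case (elim b)
            have sl: "sets (l (p s, m b)) = sets C" using ls[OF s elim(2)] by (simp add: space_prob_algebra)
            have "distr (\<kappa> s b) C g = distr (l (p s, m b)) C (\<lambda>c. c)"
              unfolding K[OF elim(2) g]
              using elim measurable_compose[OF tm g] sl
              by (intro distr_cong_AE) (auto cong: measurable_cong_sets)
            then show ?case using distr_id2[of C "l (p s, m b)"] sl by simp
          qed
        qed
        also have "\<dots> = distr (q s) D m \<bind> (\<lambda>y. l (p s, y))"
        proof (rule bind_distr[symmetric])
          show "m \<in> q s \<rightarrow>\<^sub>M D" by measurable
          show "(\<lambda>y. l (p s, y)) \<in> D \<rightarrow>\<^sub>M subprob_algebra C"
            using measurable_compose[OF measurable_Pair1'[OF ps, of D] l] by (rule measurable_prob_algebraD)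
        qed (rule q.not_empty)
        also have "\<dots> = p s" using l1 ps eq s by simp
        finally show "distr (r s) C g = p s" .
      qed
      then show ?thesis
        using rm S sb by (intro bexI[of _ r]) (auto simp: sb_hom_def standard_borel_prob_algebra)
    qed
  qed
  then show ?thesis
    unfolding weak_pullback_def using hom comm' by (auto intro: giry_map_sb_hom)
qed

section \<open>Naturality squares of the multiplication\<close>

lemma measurable_giry_mult: "giry_mult X \<in> prob_algebra (prob_algebra X) \<rightarrow>\<^sub>M prob_algebra X"
proof -
  have "(\<lambda>\<pi>. \<pi> \<bind> (\<lambda>p. p)) \<in> prob_algebra (prob_algebra X) \<rightarrow>\<^sub>M prob_algebra X"
    by (rule measurable_bind_prob_space[where N = "prob_algebra X"]) auto
  then show ?thesis by (subst measurable_cong[OF giry_mult_eq_bind])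
qed

lemma giry_mult_natural:
  assumes h: "h \<in> X \<rightarrow>\<^sub>M Y" and \<pi>: "\<pi> \<in> space (prob_algebra (prob_algebra X))"
  shows "giry_mult Y (distr \<pi> (prob_algebra Y) (giry_map Y h)) = distr (giry_mult X \<pi>) Y h"
proof -
  have s[measurable_cong]: "sets \<pi> = sets (prob_algebra X)" and P: "prob_space \<pi>"
    using \<pi> by (auto simp: space_prob_algebra)
  have ne: "space \<pi> \<noteq> {}" using P by (rule prob_space.not_empty)
  have Ph: "giry_map Y h \<in> prob_algebra X \<rightarrow>\<^sub>M prob_algebra Y" by (rule measurable_distr_prob_space[OF h])
  have "giry_mult Y (distr \<pi> (prob_algebra Y) (giry_map Y h)) = distr \<pi> (prob_algebra Y) (giry_map Y h) \<bind> (\<lambda>p. p)"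
    by (intro giry_mult_eq_bind measurable_space[OF measurable_distr_prob_space[OF Ph] \<pi>])
  also have "\<dots> = \<pi> \<bind> (\<lambda>p. distr p Y h)"
  proof (rule bind_distr)
    show "giry_map Y h \<in> \<pi> \<rightarrow>\<^sub>M prob_algebra Y" using Ph by (simp cong: measurable_cong_sets add: s)
    show "(\<lambda>p. p) \<in> prob_algebra Y \<rightarrow>\<^sub>M subprob_algebra Y" by (rule measurable_prob_algebraD) simp
  qed (rule ne)
  also have "\<dots> = distr (\<pi> \<bind> (\<lambda>p. p)) Y h"
  proof (rule distr_bind[symmetric, OF _ ne h])
    have "(\<lambda>p. p) \<in> prob_algebra X \<rightarrow>\<^sub>M subprob_algebra X" by (rule measurable_prob_algebraD) simp
    then show "(\<lambda>p. p) \<in> \<pi> \<rightarrow>\<^sub>M subprob_algebra X" by (simp cong: measurable_cong_sets add: s)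
  qed
  also have "\<dots> = distr (giry_mult X \<pi>) Y h" by (simp add: giry_mult_eq_bind[OF \<pi>])
  finally show ?thesis .
qed

text \<open>
  Associativity of \<^const>\<open>bind\<close> gives the equation with the multiplication. For the other one,
  the exceptional set of the disintegration is null for the mean of \<open>q s\<close>, hence null for
  \<open>q s\<close>-almost every \<open>\<rho>\<close>, and outside of it \<open>K y\<close> is pushed to the point mass at \<open>y\<close>.
\<close>

lemma weak_pullback_giry_mult:
  assumes hom: "h \<in> sb_hom X Y"
  shows "weak_pullback TYPE('s)
     (prob_algebra (prob_algebra X)) (prob_algebra (prob_algebra Y)) (prob_algebra X) (prob_algebra Y)
     (giry_map (prob_algebra Y) (giry_map Y h)) (giry_mult X) (giry_mult Y) (giry_map Y h)"
proof -
  have sb: "standard_borel X" "standard_borel Y" and h[measurable]: "h \<in> X \<rightarrow>\<^sub>M Y"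
    using hom by (auto simp: sb_hom_def)
  obtain k where k: "k \<in> prob_algebra X \<Otimes>\<^sub>M Y \<rightarrow>\<^sub>M prob_algebra X"
    and k1: "\<forall>p\<in>space (prob_algebra X). distr p Y h \<bind> (\<lambda>y. k (p, y)) = p"
    and k2: "\<forall>p\<in>space (prob_algebra X). AE y in distr p Y h. AE x in k (p, y). h x = y"
    using disintegration[OF sb h] .
  have "\<exists>r\<in>sb_hom S (prob_algebra (prob_algebra X)). \<forall>s\<in>space S.
      distr (r s) (prob_algebra Y) (giry_map Y h) = q s \<and> giry_mult X (r s) = p s"
    if q: "q \<in> sb_hom S (prob_algebra (prob_algebra Y))" and p: "p \<in> sb_hom S (prob_algebra X)"
      and eq: "\<forall>s\<in>space S. giry_mult Y (q s) = distr (p s) Y h" for S :: "'s measure" and q p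
  proof -
    have S: "standard_borel S" and qm[measurable]: "q \<in> S \<rightarrow>\<^sub>M prob_algebra (prob_algebra Y)"
      and pm[measurable]: "p \<in> S \<rightarrow>\<^sub>M prob_algebra X"
      using q p by (auto simp: sb_hom_def)
    define \<kappa> where "\<kappa> s \<rho> = \<rho> \<bind> (\<lambda>y. k (p s, y))" for s \<rho>
    define r where "r s = distr (q s) (prob_algebra X) (\<kappa> s)" for s
    have "(\<lambda>x. (p (fst (fst x)), snd x)) \<in> (S \<Otimes>\<^sub>M prob_algebra Y) \<Otimes>\<^sub>M Y \<rightarrow>\<^sub>M prob_algebra X \<Otimes>\<^sub>M Y" by measurable
    then have "(\<lambda>(x, y). k (p (fst x), y)) \<in> (S \<Otimes>\<^sub>M prob_algebra Y) \<Otimes>\<^sub>M Y \<rightarrow>\<^sub>M prob_algebra X"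
      unfolding split_beta' by (rule measurable_compose[OF _ k])
    then have \<kappa>: "(\<lambda>(s, \<rho>). \<kappa> s \<rho>) \<in> S \<Otimes>\<^sub>M prob_algebra Y \<rightarrow>\<^sub>M prob_algebra X"
      unfolding \<kappa>_def split_beta' by (rule measurable_bind_prob_space2[OF measurable_snd, unfolded split_beta'])
    have rm: "r \<in> S \<rightarrow>\<^sub>M prob_algebra (prob_algebra X)"
      unfolding r_def by (rule measurable_distr_prob_space2[OF qm \<kappa>])
    have "distr (r s) (prob_algebra Y) (giry_map Y h) = q s \<and> giry_mult X (r s) = p s"
      if s: "s \<in> space S" for s
    proof
      have qs: "q s \<in> space (prob_algebra (prob_algebra Y))" and ps: "p s \<in> space (prob_algebra X)"
        using s measurable_space[OF qm] measurable_space[OF pm] by auto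
      have rs: "r s \<in> space (prob_algebra (prob_algebra X))" by (rule measurable_space[OF rm s])
      interpret q: prob_space "q s" using qs by (simp add: space_prob_algebra)
      have sq[measurable_cong, simp]: "sets (q s) = sets (prob_algebra Y)" using qs by (simp add: space_prob_algebra)
      have spq: "space (q s) = space (prob_algebra Y)" by (rule sets_eq_imp_space_eq) simp
      define K where "K y = k (p s, y)" for y
      have K: "K \<in> Y \<rightarrow>\<^sub>M prob_algebra X"
        unfolding K_def using measurable_compose[OF measurable_Pair1'[OF ps, of Y] k] .
      have Ksub: "K \<in> Y \<rightarrow>\<^sub>M subprob_algebra X" by (rule measurable_prob_algebraD[OF K])
      have \<kappa>K: "\<kappa> s = (\<lambda>\<rho>. \<rho> \<bind> K)" unfolding \<kappa>_def K_def ..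
      have \<kappa>s: "\<kappa> s \<in> prob_algebra Y \<rightarrow>\<^sub>M prob_algebra X"
        using measurable_compose[OF measurable_Pair1'[OF s, of "prob_algebra Y"] \<kappa>] by simp
      have \<kappa>q: "\<kappa> s \<in> q s \<rightarrow>\<^sub>M prob_algebra X" using \<kappa>s by (simp cong: measurable_cong_sets)
      have idq: "(\<lambda>\<rho>. \<rho>) \<in> q s \<rightarrow>\<^sub>M subprob_algebra Y"
        using measurable_prob_algebraD[OF measurable_ident[of "prob_algebra Y"]]
        by (simp add: id_def cong: measurable_cong_sets)
      have mult: "distr (p s) Y h = q s \<bind> (\<lambda>\<rho>. \<rho>)"
        using eq s giry_mult_eq_bind[OF qs] by simp
      have "giry_mult X (r s) = r s \<bind> (\<lambda>p. p)" by (rule giry_mult_eq_bind[OF rs])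
      also have "\<dots> = q s \<bind> (\<lambda>\<rho>. \<rho> \<bind> K)"
        unfolding r_def \<kappa>K[symmetric]
      proof (rule bind_distr[OF \<kappa>q _ q.not_empty])
        show "(\<lambda>p. p) \<in> prob_algebra X \<rightarrow>\<^sub>M subprob_algebra X" by (rule measurable_prob_algebraD) simp
      qed
      also have "\<dots> = q s \<bind> (\<lambda>\<rho>. \<rho>) \<bind> K" by (rule bind_assoc[symmetric, OF idq Ksub])
      also have "\<dots> = p s" using k1 ps unfolding mult[symmetric] K_def by simp
      finally show "giry_mult X (r s) = p s" .
      have "AE y in q s \<bind> (\<lambda>\<rho>. \<rho>). AE x in K y. h x = y"
        using k2 ps unfolding mult[symmetric] K_def by simp
      \<comment> \<open>Only a measurable null set can be passed through the mean, so the exceptional set is enlarged.\<close>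
      then obtain N where N: "{y \<in> space (q s \<bind> (\<lambda>\<rho>. \<rho>)). \<not> (AE x in K y. h x = y)} \<subseteq> N"
        "emeasure (q s \<bind> (\<lambda>\<rho>. \<rho>)) N = 0" "N \<in> sets (q s \<bind> (\<lambda>\<rho>. \<rho>))"
        by (rule AE_E)
      have sb': "sets (q s \<bind> (\<lambda>\<rho>. \<rho>)) = sets Y" unfolding mult[symmetric] by simp
      have spb: "space (q s \<bind> (\<lambda>\<rho>. \<rho>)) = space Y" using sb' by (rule sets_eq_imp_space_eq)
      have NY: "N \<in> sets Y" using N(3) sb' by simp
      have "AE y in q s \<bind> (\<lambda>\<rho>. \<rho>). y \<notin> N" using N(2,3) by (intro AE_not_in) auto
      then have "AE \<rho> in q s. AE y in \<rho>. y \<notin> N"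
        using AE_bind[OF idq, of "\<lambda>y. y \<notin> N"] NY by simp
      moreover have "AE \<rho> in q s. \<rho> \<in> space (prob_algebra Y)" using spq by (intro AE_I2) simp
      ultimately have ae: "AE \<rho> in q s. distr (\<kappa> s \<rho>) Y h = \<rho>"
      proof eventually_elim
        case (elim \<rho>)
        have s\<rho>: "sets \<rho> = sets Y" and P\<rho>: "prob_space \<rho>" using elim(2) by (auto simp: space_prob_algebra)
        have "distr (\<rho> \<bind> K) Y h = \<rho> \<bind> (\<lambda>y. distr (K y) Y h)"
          using Ksub prob_space.not_empty[OF P\<rho>] s\<rho>
          by (intro distr_bind[OF _ _ h]) (auto cong: measurable_cong_sets)
        also have "\<dots> = \<rho> \<bind> return Y"
        proof (rule bind_cong_AE'[OF elim(2)])
          show "(\<lambda>y. distr (K y) Y h) \<in> Y \<rightarrow>\<^sub>M prob_algebra Y"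
            by (rule measurable_compose[OF K measurable_distr_prob_space[OF h]])
          have "AE y in \<rho>. y \<in> space Y" using sets_eq_imp_space_eq[OF s\<rho>] by (intro AE_I2) simp
          with elim(1) show "AE y in \<rho>. distr (K y) Y h = return Y y"
          proof eventually_elim
            case (elim y)
            have Ky: "K y \<in> space (prob_algebra X)" using measurable_space[OF K elim(2)] .
            then interpret K: prob_space "K y" by (simp add: space_prob_algebra)
            have [measurable_cong]: "sets (K y) = sets X" using Ky by (simp add: space_prob_algebra)
            have "AE x in K y. h x = y" using N(1) elim spb by blast
            then have "distr (K y) Y h = distr (K y) Y (\<lambda>_. y)"
              using elim(2) by (intro distr_cong_AE) auto
            then show ?case using elim(2) by simp
          qed
        qed simp
        also have "\<dots> = \<rho>" by (rule bind_return''[OF s\<rho>])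
        finally show ?case unfolding \<kappa>K .
      qed
      have Ph: "giry_map Y h \<in> prob_algebra X \<rightarrow>\<^sub>M prob_algebra Y" by (rule measurable_distr_prob_space[OF h])
      have "distr (r s) (prob_algebra Y) (giry_map Y h) = distr (q s) (prob_algebra Y) (\<lambda>\<rho>. distr (\<kappa> s \<rho>) Y h)"
        unfolding r_def using distr_distr[OF Ph \<kappa>q] by (simp add: comp_def)
      also have "\<dots> = distr (q s) (prob_algebra Y) (\<lambda>\<rho>. \<rho>)"
      proof (rule distr_cong_AE)
        show "(\<lambda>\<rho>. distr (\<kappa> s \<rho>) Y h) \<in> q s \<rightarrow>\<^sub>M prob_algebra Y" by (rule measurable_compose[OF \<kappa>q Ph])
        show "(\<lambda>\<rho>. \<rho>) \<in> q s \<rightarrow>\<^sub>M prob_algebra Y" by (simp cong: measurable_cong_sets)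
      qed (use ae in auto)
      also have "\<dots> = q s" by (rule distr_id2) simp
      finally show "distr (r s) (prob_algebra Y) (giry_map Y h) = q s" .
    qed
    then show ?thesis
      using rm S sb by (intro bexI[of _ r]) (auto simp: sb_hom_def standard_borel_prob_algebra)
  qed
  moreover have "giry_mult Z \<in> sb_hom (prob_algebra (prob_algebra Z)) (prob_algebra Z)"
    if "standard_borel Z" for Z :: "'z measure"
    using that measurable_giry_mult by (auto simp: sb_hom_def standard_borel_prob_algebra)
  moreover have "standard_borel X" "standard_borel Y" by fact+
  ultimately show ?thesis
    unfolding weak_pullback_def using giry_map_sb_hom[OF hom] giry_mult_natural[OF h]
    by (auto intro!: giry_map_sb_hom simp: sb measurable_giry_mult sb_hom_def standard_borel_prob_algebra)
qed

theorem corollary3p9: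
  fixes A :: "'a measure" and B :: "'b measure" and C :: "'c measure" and D :: "'d measure"
    and f :: "'a \<Rightarrow> 'b" and g :: "'a \<Rightarrow> 'c" and m :: "'b \<Rightarrow> 'd" and n :: "'c \<Rightarrow> 'd"
    and X :: "'x measure" and Y :: "'y measure" and h :: "'x \<Rightarrow> 'y"
  shows "(weak_pullback TYPE(real) A B C D f g m n \<longrightarrow>
           weak_pullback TYPE('s)
             (prob_algebra A) (prob_algebra B) (prob_algebra C) (prob_algebra D)
             (giry_map B f) (giry_map C g) (giry_map D m) (giry_map D n)) \<and>
         (h \<in> sb_hom X Y \<longrightarrow>
           weak_pullback TYPE('s)
             (prob_algebra (prob_algebra X)) (prob_algebra (prob_algebra Y))
             (prob_algebra X) (prob_algebra Y)
             (giry_map (prob_algebra Y) (giry_map Y h)) (giry_mult X)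
             (giry_mult Y) (giry_map Y h))"
  using weak_pullback_prob_algebra weak_pullback_giry_mult by blast

end
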